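(* The minimum number of faces ($2$-dimensional faces) that a mono-unstable $0$-skeleton in $\mathbb{R}^3$ may have is $8$. That is, there exists a $3$-dimensional convex polytope in $\mathbb{R}^3$ with exactly $8$ faces that is mono-unstable as a $0$-skeleton, and every $3$-dimensional convex polytope in $\mathbb{R}^3$ that is mono-unstable as a $0$-skeleton has at least $8$ faces.
   Context: Let $P\subseteq\mathbb{R}^d$ be a $d$-dimensional (bounded) convex polytope with vertices $r_1,\dots,r_V$. Regarded as a $0$-skeleton, $P$ carries a unit point mass at each of its vertices (and no other mass), so its center of mass is $g=\frac1V\sum_{i=1}^V r_i$, which lies in the interior of $P$. A point $q$ of the boundary of $P$ is an equilibrium point (with respect to $g$) if the hyperplane $h$ through $q$ perpendicular to the line segment $[g,q]$ supports $P$ at $q$. An equilibrium point $q$ is nondegenerate if $h\cap P$ is the unique face of $P$ (of dimension $k\in\{0,1,\dots,d-1\}$) that contains $q$ in its relative interior. A nondegenerate equilibrium point $q$ is unstable if $\dim(h\cap P)=0$; equivalently, $q$ is a vertex of $P$ and $h\cap P=\{q\}$. Only nondegenerate equilibrium points are counted; $U$ denotes the number of unstable equilibria. A $0$-skeleton is mono-unstable if $U=1$. Here $d=3$, and the number of faces of $P$ means its number of $2$-dimensional faces (facets). *)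

theory Defs
  imports "HOL-Analysis.Analysis"
begin

definition polytope_vertices :: "'a::euclidean_space set \<Rightarrow> 'a set" where
  "polytope_vertices P = {v. v extreme_point_of P}"

text \<open>The suffix 0 marks notions for 0-skeletons: unit masses at the vertices, no other mass.\<close>

definition center_of_mass0 :: "'a::euclidean_space set \<Rightarrow> 'a" where
  "center_of_mass0 P =
     (1 / real (card (polytope_vertices P))) *\<^sub>R (\<Sum>v\<in>polytope_vertices P. v)"

text \<open>The hyperplane through \<open>q\<close> perpendicular to the segment \<open>[g, q]\<close>; this is a hyperplane
  only for \<open>q \<noteq> g\<close>, which holds below because \<open>g\<close> is interior and \<open>q\<close> is on the boundary.\<close>

definition perp_hyperplane :: "'a::euclidean_space \<Rightarrow> 'a \<Rightarrow> 'a set" where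
  "perp_hyperplane g q = {x. (q - g) \<bullet> (x - q) = 0}"

definition equilibrium_point :: "'a::euclidean_space set \<Rightarrow> 'a \<Rightarrow> 'a \<Rightarrow> bool" where
  "equilibrium_point P g q \<longleftrightarrow>
     q \<in> frontier P \<and> q \<in> P \<and>
     ((\<forall>x\<in>P. (q - g) \<bullet> (x - q) \<le> 0) \<or> (\<forall>x\<in>P. (q - g) \<bullet> (x - q) \<ge> 0))"

text \<open>In the library both \<open>{}\<close> (of affine dimension -1) and \<open>P\<close> itself are faces of \<open>P\<close>; the
  dimension bounds exclude them.\<close>

definition nondegenerate_equilibrium :: "'a::euclidean_space set \<Rightarrow> 'a \<Rightarrow> 'a \<Rightarrow> bool" where
  "nondegenerate_equilibrium P g q \<longleftrightarrow>
     equilibrium_point P g q \<and>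
     {F. F face_of P \<and> 0 \<le> aff_dim F \<and> aff_dim F < aff_dim P \<and> q \<in> rel_interior F} =
       {perp_hyperplane g q \<inter> P}"

definition unstable_equilibrium :: "'a::euclidean_space set \<Rightarrow> 'a \<Rightarrow> 'a \<Rightarrow> bool" where
  "unstable_equilibrium P g q \<longleftrightarrow>
     nondegenerate_equilibrium P g q \<and> aff_dim (perp_hyperplane g q \<inter> P) = 0"

definition mono_unstable0 :: "'a::euclidean_space set \<Rightarrow> bool" where
  "mono_unstable0 P \<longleftrightarrow> card {q. unstable_equilibrium P (center_of_mass0 P) q} = 1"

definition num_faces2 :: "'a::euclidean_space set \<Rightarrow> nat" where
  "num_faces2 P = card {F. F face_of P \<and> aff_dim F = 2}"

end

theory Submission
  imports Defs
begin

text \<open>Place the origin at the centre of mass. The vertex \<open>r\<close> farthest from it is an unstable equilibrium;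
  a vertex \<open>x\<close> is not one exactly if some other vertex \<open>y\<close> satisfies \<open>x \<bullet> x \<le> x \<bullet> y\<close>, that is, if \<open>x\<close> lies
  in the ball with diameter from \<open>0\<close> to \<open>y\<close>. In a mono-unstable 0-skeleton the choice of such a \<open>y\<close> as
  parent of \<open>x\<close> makes the vertices a tree with root \<open>r\<close>, and the vertices sum to zero.

  The main point is that this is impossible with ten or fewer vertices, in any dimension
  (\<open>no_small_tree\<close>). Going down the tree, a vector can turn away from \<open>r\<close> only at the cost of its length,
  so it takes many vectors to balance \<open>r\<close>. To measure this, fix a vector \<open>y\<close> and consider the sum of
  \<open>y \<bullet> x\<close> over all descendants \<open>x\<close> of a vector \<open>p\<close>. For a given number of descendants the least value
  occurs when they form a single chain (\<open>forest_bound\<close>): moving everything to the lowest point found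
  does not increase the sum. Hence the shape of the tree disappears, and for chains there is a
  recursion for bounds \<open>B * (y \<bullet> p) - D * norm p * norm y\<close> (\<open>chain_step_bound\<close>). If all branches at the
  root are small, \<open>y = r\<close> gives the contradiction. Otherwise there is one dominant branch, starting at a
  child \<open>c\<close> of \<open>r\<close>, and a suitable combination \<open>y\<close> of \<open>r\<close> and \<open>c\<close> does (\<open>two_forest_contradiction\<close>).

  A three-dimensional polytope with \<open>F\<close> facets has at most \<open>2 * F - 4\<close> vertices
  (\<open>vertices_le_facets\<close>), so at most seven facets would mean at most ten vertices.

  The example with eight facets is a wedge whose twelve vertices form two symmetric spirals. The two
  general results also serve here: twelve known vertices are all vertices since there are no more than
  eight facets, and there are no fewer facets since the polytope is mono-unstable.\<close>

section \<open>Trees of vectors with sum zero\<close>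

text \<open>A pair \<open>(B, D)\<close> stands for the lower bound \<open>B * (y \<bullet> p) - D * norm p * norm y\<close> on the sum of
  \<open>y \<bullet> x\<close> over a chain of \<open>m\<close> vectors below \<open>p\<close>. With \<open>norm p = norm y = 1\<close> the least possible sum
  depends on the cosine \<open>y \<bullet> p\<close> only, and each pair is a line below the graph of this function.
  Different choices of \<open>B'\<close> give (almost) its various tangents, so the table of pairs used below is a
  choice of tangent points.\<close>

inductive chain_bound :: "nat \<Rightarrow> real \<Rightarrow> real \<Rightarrow> bool" where
  zero: "chain_bound 0 0 0"
| one: "chain_bound 1 (1/2) (1/2)"
| step: "\<lbrakk>chain_bound m B D; 0 \<le> B; 1 + B < 2 * B'; 0 \<le> D';
          B'\<^sup>2 * (1 + D\<^sup>2 / ((1 + B) * (2 * B' - 1 - B))) \<le> D'\<^sup>2\<rbrakk>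
         \<Longrightarrow> chain_bound (Suc m) B' D'"

fun chain :: "'a::real_inner \<Rightarrow> 'a list \<Rightarrow> bool" where
  "chain p [] = True"
| "chain p (x # xs) = (x \<bullet> x \<le> x \<bullet> p \<and> chain x xs)"

lemma chain_append: "chain p (xs @ ys) \<longleftrightarrow> chain p xs \<and> chain (last (p # xs)) ys"
  by (induction xs arbitrary: p) auto

lemma chain_replicate: "x \<bullet> x \<le> x \<bullet> p \<Longrightarrow> chain p (replicate n x)"
proof (induction n arbitrary: p)
  case (Suc n)
  then show ?case by simp
qed simp

text \<open>The condition \<open>x \<bullet> x \<le> x \<bullet> p\<close> says that \<open>x\<close> lies in the ball with diameter from \<open>0\<close> to \<open>p\<close>.\<close>

lemma leaf_bound:
  fixes x p y :: "'a::real_inner"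
  assumes "x \<bullet> x \<le> x \<bullet> p"
  shows "(1/2) * (y \<bullet> p) - (1/2) * norm p * norm y \<le> y \<bullet> x"
proof -
  have "(norm (x - (1/2) *\<^sub>R p))\<^sup>2 \<le> (norm ((1/2) *\<^sub>R p))\<^sup>2"
    unfolding power2_norm_eq_inner using assms by (simp add: algebra_simps inner_commute)
  then have "norm (x - (1/2) *\<^sub>R p) \<le> norm p / 2"
    using power2_le_imp_le by fastforce
  then have "norm y * norm (x - (1/2) *\<^sub>R p) \<le> norm y * (norm p / 2)"
    by (intro mult_left_mono) auto
  moreover have "\<bar>y \<bullet> (x - (1/2) *\<^sub>R p)\<bar> \<le> norm y * norm (x - (1/2) *\<^sub>R p)"
    by (rule Cauchy_Schwarz_ineq2)
  ultimately show ?thesis by (simp add: inner_diff_right algebra_simps)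
qed

text \<open>The right-hand side is to be minimised over the ball with diameter from \<open>0\<close> to \<open>p\<close>. Adding
  \<open>l * (x \<bullet> x - x \<bullet> p)\<close> and estimating \<open>D * norm x * norm y\<close> by a sum of two squares leaves a quadratic
  in \<open>x\<close>, whose minimum is explicit; the multiplier \<open>l\<close> and the weight \<open>a\<close> of the squares are the
  optimal ones for the slope \<open>B'\<close>.\<close>

lemma chain_step_bound:
  fixes x p y :: "'a::real_inner"
  assumes x: "x \<bullet> x \<le> x \<bullet> p" and B: "0 \<le> B" "1 + B < 2 * B'" "0 \<le> D'"
    and D: "B'\<^sup>2 * (1 + D\<^sup>2 / ((1 + B) * (2 * B' - 1 - B))) \<le> D'\<^sup>2"
  shows "B' * (y \<bullet> p) - D' * norm p * norm y \<le> (1 + B) * (y \<bullet> x) - D * norm x * norm y"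
proof (cases "p = 0 \<or> y = 0")
  case True
  then show ?thesis
  proof
    assume "p = 0"
    then have "x = 0" using x by (metis inner_eq_zero_iff inner_ge_zero inner_zero_right order_antisym)
    with \<open>p = 0\<close> show ?thesis by simp
  qed simp
next
  case False
  then have np: "norm p > 0" and ny: "norm y > 0" by auto
  define b where "b = 1 + B"
  define e where "e = 2 * B' - b"
  have b: "b > 0" and e: "e > 0" and B': "B' > 0" using B by (auto simp: e_def b_def)
  have Dbe: "B'\<^sup>2 * (1 + D\<^sup>2 / (b * e)) \<le> D'\<^sup>2"
    using D by (simp add: b_def e_def diff_diff_eq)
  have "0 < B'\<^sup>2 * (1 + D\<^sup>2 / (b * e))"
    using b e B' by (intro mult_pos_pos add_pos_nonneg) auto
  with Dbe have "0 < D'\<^sup>2" by linarith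
  with B have D': "D' > 0" by (simp add: order_less_le)
  define l where "l = b * D' * norm y / (B' * norm p)"
  define a where "a = l * e / (2 * B')"
  define d where "d = l * b / (2 * B')"
  define w where "w = b *\<^sub>R y - l *\<^sub>R p"
  have l: "l > 0" using b D' ny np B' by (simp add: l_def)
  have a: "a > 0" and d: "d > 0" using l b e B' by (simp_all add: a_def d_def)
  have lad: "l = a + d" using B' by (simp add: a_def d_def e_def field_simps)
  have 1: "D * norm x * norm y \<le> a * (norm x)\<^sup>2 + D\<^sup>2 * (norm y)\<^sup>2 / (4 * a)"
  proof -
    have "0 \<le> (2 * a * norm x - D * norm y)\<^sup>2 / (4 * a)" using a by simp
    then show ?thesis using a by (simp add: power2_eq_square field_simps)
  qed
  have 2: "0 \<le> d * (norm x)\<^sup>2 + x \<bullet> w + (norm w)\<^sup>2 / (4 * d)"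
  proof -
    have "0 \<le> (norm ((2 * d) *\<^sub>R x + w))\<^sup>2 / (4 * d)" using d by simp
    also have "\<dots> = d * (norm x)\<^sup>2 + x \<bullet> w + (norm w)\<^sup>2 / (4 * d)"
      unfolding power2_norm_eq_inner using d
      by (simp add: inner_add_left inner_add_right inner_commute field_simps)
    finally show ?thesis .
  qed
  have 3: "(norm w)\<^sup>2 = b\<^sup>2 * (norm y)\<^sup>2 - 2 * b * l * (y \<bullet> p) + l\<^sup>2 * (norm p)\<^sup>2"
    unfolding power2_norm_eq_inner w_def
    by (simp add: inner_diff_left inner_diff_right inner_commute power2_eq_square algebra_simps)
  have 4: "(norm w)\<^sup>2 / (4 * d) = b * B' * (norm y)\<^sup>2 / (2 * l) - B' * (y \<bullet> p) + l * B' * (norm p)\<^sup>2 / (2 * b)"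
    unfolding 3 d_def using b l B' by (simp add: field_simps power2_eq_square)
  have 5: "D\<^sup>2 * (norm y)\<^sup>2 / (4 * a) = D\<^sup>2 * B' * (norm y)\<^sup>2 / (2 * l * e)"
    unfolding a_def using l e B' by (simp add: field_simps)
  have 6: "b * B' * (norm y)\<^sup>2 / (2 * l) + D\<^sup>2 * B' * (norm y)\<^sup>2 / (2 * l * e)
      = (b * (norm y)\<^sup>2 / (2 * l * B')) * (B'\<^sup>2 * (1 + D\<^sup>2 / (b * e)))"
    using b l e B' by (simp add: field_simps power2_eq_square)
  have 7: "\<dots> \<le> (b * (norm y)\<^sup>2 / (2 * l * B')) * D'\<^sup>2"
    using Dbe b l B' by (intro mult_left_mono) auto
  have 8: "(b * (norm y)\<^sup>2 / (2 * l * B')) * D'\<^sup>2 = D' * norm p * norm y / 2"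
    using b B' D' ny np by (simp add: l_def field_simps power2_eq_square)
  have 9: "l * B' * (norm p)\<^sup>2 / (2 * b) = D' * norm p * norm y / 2"
    using b B' D' ny np by (simp add: l_def field_simps power2_eq_square)
  have "x \<bullet> w = b * (y \<bullet> x) - l * (x \<bullet> p)"
    by (simp add: w_def inner_diff_right inner_commute)
  moreover have "l * (norm x)\<^sup>2 \<le> l * (x \<bullet> p)"
    using x l by (simp add: power2_norm_eq_inner)
  moreover have "l * (norm x)\<^sup>2 = a * (norm x)\<^sup>2 + d * (norm x)\<^sup>2" by (simp add: lad algebra_simps)
  ultimately show ?thesis
    using 1 2 4 5 6 7 8 9 unfolding b_def[symmetric] by linarith
qed

lemma chain_bound_nonneg: "chain_bound m B D \<Longrightarrow> 0 \<le> B \<and> 0 \<le> D"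
  by (induction rule: chain_bound.induct) auto

lemma chain_bound_sum:
  fixes p y :: "'a::real_inner"
  assumes "chain_bound m B D" "chain p xs" "length xs = m"
  shows "B * (y \<bullet> p) - D * norm p * norm y \<le> (\<Sum>x\<leftarrow>xs. y \<bullet> x)"
  using assms
proof (induction arbitrary: p xs rule: chain_bound.induct)
  case zero
  then show ?case by simp
next
  case one
  then obtain x where "xs = [x]" by (metis One_nat_def length_0_conv length_Suc_conv)
  then show ?case using leaf_bound[of x p y] one by simp
next
  case (step m B D B' D')
  then obtain x xs' where xs: "xs = x # xs'" "length xs' = m" by (metis length_Suc_conv)
  with step have x: "x \<bullet> x \<le> x \<bullet> p" and c: "chain x xs'" by auto
  have "B * (y \<bullet> x) - D * norm x * norm y \<le> (\<Sum>z\<leftarrow>xs'. y \<bullet> z)"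
    using step.IH[OF c xs(2)] .
  moreover have "B' * (y \<bullet> p) - D' * norm p * norm y \<le> (1 + B) * (y \<bullet> x) - D * norm x * norm y"
    using step.hyps by (intro chain_step_bound[OF x]) auto
  ultimately show ?case by (simp add: xs algebra_simps)
qed

text \<open>\<open>f\<close> is a parent map, and \<open>S\<close> consists of trees hanging below \<open>p\<close>. The growth of the norm excludes
  cycles, so that every element of \<open>S\<close> leads to \<open>p\<close>.\<close>

definition forest :: "('a::real_inner \<Rightarrow> 'a) \<Rightarrow> 'a \<Rightarrow> 'a set \<Rightarrow> bool" where
  "forest f p S \<longleftrightarrow> finite S \<and>
     (\<forall>x\<in>S. f x \<in> insert p S \<and> x \<bullet> x \<le> x \<bullet> f x \<and> norm x < norm (f x))"

lemma forest_chain: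
  assumes "forest f p S" "v \<in> S"
  shows "\<exists>xs. chain p xs \<and> xs \<noteq> [] \<and> last xs = v \<and> distinct xs \<and> set xs \<subseteq> S
              \<and> (\<forall>u\<in>set xs. norm v \<le> norm u)"
  using assms(2)
proof (induction "card {u \<in> S. norm v < norm u}" arbitrary: v rule: less_induct)
  case less
  have fin: "finite S" and fv: "f v \<in> insert p S" "v \<bullet> v \<le> v \<bullet> f v" "norm v < norm (f v)"
    using assms(1) less.prems by (auto simp: forest_def)
  show ?case
  proof (cases "f v = p")
    case True
    then show ?thesis using fv less.prems by (intro exI[of _ "[v]"]) auto
  next
    case False
    with fv have fS: "f v \<in> S" by simp
    have "card {u \<in> S. norm (f v) < norm u} < card {u \<in> S. norm v < norm u}"
      using fin fv fS by (intro psubset_card_mono) auto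
    from less.hyps[OF this fS] obtain xs where xs: "chain p xs" "xs \<noteq> []" "last xs = f v"
      "distinct xs" "set xs \<subseteq> S" "\<forall>u\<in>set xs. norm (f v) \<le> norm u" by blast
    have "v \<notin> set xs" using xs fv by force
    then show ?thesis
      using xs fv less.prems
      by (intro exI[of _ "xs @ [v]"]) (auto simp: chain_append intro: less_imp_le order_trans)
  qed
qed

text \<open>This reduces trees to chains. If \<open>y \<bullet> x\<close> is least at \<open>v\<close>, all elements off the path from \<open>p\<close> to
  \<open>v\<close> may be replaced by copies of \<open>v\<close>, which only decreases the sum; and copies of \<open>v\<close> prolong the path
  to a chain because \<open>v \<bullet> v \<le> v \<bullet> v\<close>.\<close>

lemma forest_bound:
  fixes p y :: "'a::real_inner"
  assumes F: "forest f p S" and m: "card S \<le> m" and cb: "chain_bound m B D"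
  shows "B * (y \<bullet> p) - D * norm p * norm y \<le> (\<Sum>x\<in>S. y \<bullet> x)"
proof (cases "\<forall>x\<in>S. 0 \<le> y \<bullet> x")
  case True
  have "B * (y \<bullet> p) - D * norm p * norm y \<le> (\<Sum>x\<leftarrow>replicate m 0. y \<bullet> x)"
    by (intro chain_bound_sum[OF cb] chain_replicate) auto
  also have "\<dots> = 0" by (simp add: sum_list_replicate)
  also have "0 \<le> (\<Sum>x\<in>S. y \<bullet> x)" using True by (intro sum_nonneg) auto
  finally show ?thesis .
next
  case False
  have fin: "finite S" using F by (simp add: forest_def)
  define v where "v = arg_min_on (\<lambda>x. y \<bullet> x) S"
  have v: "v \<in> S" "\<And>x. x \<in> S \<Longrightarrow> y \<bullet> v \<le> y \<bullet> x"
    using False arg_min_if_finite(1)[OF fin, of "\<lambda>x. y \<bullet> x"] arg_min_least[OF fin, of _ "\<lambda>x. y \<bullet> x"]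
    by (auto simp: v_def)
  with False have neg: "y \<bullet> v < 0" by force
  obtain xs where xs: "chain p xs" "xs \<noteq> []" "last xs = v" "distinct xs" "set xs \<subseteq> S"
    using forest_chain[OF F v(1)] by blast
  have len: "length xs = card (set xs)" using xs by (simp add: distinct_card)
  have le: "length xs \<le> m" using len m card_mono[OF fin xs(5)] by simp
  \<comment> \<open>the path to \<open>v\<close>, prolonged by copies of \<open>v\<close>\<close>
  define zs where "zs = xs @ replicate (m - length xs) v"
  have "chain p zs" using xs by (auto simp: zs_def chain_append intro: chain_replicate)
  moreover have "length zs = m" using le by (simp add: zs_def)
  ultimately have "B * (y \<bullet> p) - D * norm p * norm y \<le> (\<Sum>x\<leftarrow>zs. y \<bullet> x)"
    by (intro chain_bound_sum[OF cb])
  also have "\<dots> = (\<Sum>x\<in>set xs. y \<bullet> x) + real (m - length xs) * (y \<bullet> v)"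
    using xs by (simp add: zs_def sum_list_distinct_conv_sum_set sum_list_replicate)
  also have "\<dots> \<le> (\<Sum>x\<in>set xs. y \<bullet> x) + real (card (S - set xs)) * (y \<bullet> v)"
    using neg m xs fin len by (auto simp: card_Diff_subset)
  also have "\<dots> \<le> (\<Sum>x\<in>set xs. y \<bullet> x) + (\<Sum>x\<in>S - set xs. y \<bullet> x)"
    using sum_bounded_below[of "S - set xs" "y \<bullet> v" "\<lambda>x. y \<bullet> x"] v by auto
  also have "\<dots> = (\<Sum>x\<in>S. y \<bullet> x)" using sum.subset_diff[OF xs(5) fin, of "\<lambda>x. y \<bullet> x"] by simp
  finally show ?thesis .
qed


text \<open>\<open>top x\<close> is the child of the root from which \<open>x\<close> descends.\<close>

lemma branch_function:
  assumes F: "forest f r N" and r: "r \<notin> N"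
  obtains top where "\<And>x. x \<in> N \<Longrightarrow> top x \<in> N \<and> f (top x) = r"
    "\<And>x. x \<in> N \<Longrightarrow> f x = r \<Longrightarrow> top x = x"
    "\<And>x. x \<in> N \<Longrightarrow> f x \<noteq> r \<Longrightarrow> top x = top (f x)"
proof -
  define n where "n = (\<lambda>x. LEAST k. f ((f ^^ k) x) = r)"
  have ex: "\<exists>k. f ((f ^^ k) x) = r" if "x \<in> N" for x
    using that
  proof (induction "card {u \<in> N. norm x < norm u}" arbitrary: x rule: less_induct)
    case less
    have fin: "finite N" and fx: "f x \<in> insert r N" "norm x < norm (f x)"
      using F less.prems by (auto simp: forest_def)
    show ?case
    proof (cases "f x = r")
      case True
      then show ?thesis by (intro exI[of _ 0]) simp
    next
      case False
      with fx have fN: "f x \<in> N" by simp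
      have "card {u \<in> N. norm (f x) < norm u} < card {u \<in> N. norm x < norm u}"
        using fin fx fN by (intro psubset_card_mono) auto
      from less.hyps[OF this fN] obtain k where "f ((f ^^ k) (f x)) = r" by blast
      then show ?thesis by (intro exI[of _ "Suc k"]) (simp add: funpow_swap1)
    qed
  qed
  have n0: "n x = 0" if "f x = r" for x
    unfolding n_def by (rule Least_equality) (use that in auto)
  have nS: "n x = Suc (n (f x))" if "x \<in> N" "f x \<noteq> r" for x
  proof -
    from ex[OF that(1)] obtain k where "f ((f ^^ k) x) = r" ..
    then have "(LEAST k. f ((f ^^ k) x) = r) = Suc (LEAST k. f ((f ^^ Suc k) x) = r)"
      using that(2) by (intro Least_Suc) auto
    then show ?thesis by (simp add: n_def funpow_swap1)
  qed
  define top where "top = (\<lambda>x. (f ^^ n x) x)"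
  have 1: "f (top x) = r" if "x \<in> N" for x
    unfolding top_def n_def using LeastI_ex[OF ex[OF that]] by simp
  have 2: "top x = x" if "f x = r" for x using n0[OF that] by (simp add: top_def)
  have 3: "top x = top (f x)" if "x \<in> N" "f x \<noteq> r" for x
    using nS[OF that] by (simp add: top_def funpow_swap1)
  have 4: "top x \<in> N" if "x \<in> N" for x
    using that
  proof (induction "n x" arbitrary: x)
    case 0
    then show ?case by (simp add: top_def)
  next
    case (Suc k)
    then have nr: "f x \<noteq> r" using n0 by fastforce
    with Suc.prems F have "f x \<in> N" by (auto simp: forest_def)
    then show ?case using Suc nS[OF Suc.prems nr] 3[OF Suc.prems nr] by simp
  qed
  show thesis using that[of top] 1 2 3 4 by blast
qed

text \<open>Here \<open>c\<close> is a child of the root \<open>r\<close>, \<open>M\<close> its descendants and \<open>T\<close> the rest. For any \<open>y\<close> the two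
  forest bounds add up to
  \<open>0 \<ge> y \<bullet> ((1 + Bs) *\<^sub>R r + (1 + Bm) *\<^sub>R c) - (Ds * norm r + Dm * norm c) * norm y\<close>. The best \<open>y\<close> is the
  vector \<open>w\<close> that occurs in the inner product, and what remains is a comparison of its norm with
  \<open>Ds * norm r + Dm * norm c\<close>, a quadratic inequality in \<open>\<rho> = norm c / norm r\<close>. Projecting on \<open>r\<close>
  alone would not suffice: a single chain that is long enough can balance the root in that direction,
  but it then has a large component across it.\<close>

lemma two_forest_contradiction:
  fixes r c :: "'a::real_inner"
  assumes T: "forest f r T" "card T \<le> s" "chain_bound s Bs Ds"
    and M: "forest f c M" "card M \<le> m" "chain_bound m Bm Dm"
    and c: "c \<bullet> c \<le> c \<bullet> r" and r: "r \<noteq> 0"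
    and sum0: "r + c + (\<Sum>x\<in>T. x) + (\<Sum>x\<in>M. x) = 0"
    and num: "\<And>\<rho>. 0 \<le> \<rho> \<Longrightarrow> \<rho> \<le> 1 \<Longrightarrow>
      (Ds + Dm * \<rho>)\<^sup>2 < (1 + Bs)\<^sup>2 + (2 * (1 + Bs) * (1 + Bm) + (1 + Bm)\<^sup>2) * \<rho>\<^sup>2"
  shows False
proof -
  define w where "w = (1 + Bs) *\<^sub>R r + (1 + Bm) *\<^sub>R c"
  have nn: "0 \<le> Bs" "0 \<le> Ds" "0 \<le> Bm" "0 \<le> Dm"
    using chain_bound_nonneg T(3) M(3) by blast+
  have "0 = w \<bullet> (r + c + (\<Sum>x\<in>T. x) + (\<Sum>x\<in>M. x))" using sum0 by simp
  also have "\<dots> = w \<bullet> r + w \<bullet> c + (\<Sum>x\<in>T. w \<bullet> x) + (\<Sum>x\<in>M. w \<bullet> x)"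
    by (simp add: inner_add_right inner_sum_right)
  also have "\<dots> \<ge> w \<bullet> r + w \<bullet> c + (Bs * (w \<bullet> r) - Ds * norm r * norm w)
      + (Bm * (w \<bullet> c) - Dm * norm c * norm w)"
    using forest_bound[OF T, of w] forest_bound[OF M, of w] by linarith
  also have "w \<bullet> r + w \<bullet> c + (Bs * (w \<bullet> r) - Ds * norm r * norm w)
      + (Bm * (w \<bullet> c) - Dm * norm c * norm w)
      = (norm w)\<^sup>2 - (Ds * norm r + Dm * norm c) * norm w"
    by (simp add: w_def power2_norm_eq_inner algebra_simps)
  finally have le: "(norm w) * norm w \<le> (Ds * norm r + Dm * norm c) * norm w"
    by (simp add: power2_eq_square)
  define \<rho> where "\<rho> = norm c / norm r"
  have nr: "norm r > 0" using r by simp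
  have "norm c * norm c \<le> norm c * norm r"
    using c Cauchy_Schwarz_ineq2[of c r] by (simp add: norm_eq_sqrt_inner flip: real_sqrt_mult)
  then have "norm c \<le> norm r" by (metis mult_left_le_imp_le mult_zero_left norm_ge_zero norm_zero order_le_less zero_less_norm_iff norm_eq_zero)
  then have \<rho>: "0 \<le> \<rho>" "\<rho> \<le> 1" using nr by (auto simp: \<rho>_def)
  have cr: "norm c = \<rho> * norm r" using nr by (simp add: \<rho>_def)
  have w2: "(norm w)\<^sup>2 = (1 + Bs)\<^sup>2 * (norm r)\<^sup>2 + 2 * (1 + Bs) * (1 + Bm) * (c \<bullet> r) + (1 + Bm)\<^sup>2 * (norm c)\<^sup>2"
    unfolding w_def power2_norm_eq_inner
    by (simp add: inner_add_left inner_add_right inner_commute power2_eq_square algebra_simps)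
  have "2 * (1 + Bs) * (1 + Bm) * (norm c)\<^sup>2 \<le> 2 * (1 + Bs) * (1 + Bm) * (c \<bullet> r)"
    using c nn by (intro mult_left_mono) (auto simp: power2_norm_eq_inner)
  then have w_ge: "((1 + Bs)\<^sup>2 + (2 * (1 + Bs) * (1 + Bm) + (1 + Bm)\<^sup>2) * \<rho>\<^sup>2) * (norm r)\<^sup>2 \<le> (norm w)\<^sup>2"
    unfolding w2 unfolding cr by (simp add: algebra_simps power_mult_distrib)
  have "(Ds * norm r + Dm * norm c)\<^sup>2 = ((Ds + Dm * \<rho>) * norm r)\<^sup>2"
    by (simp add: cr distrib_right mult.assoc)
  also have "\<dots> = (Ds + Dm * \<rho>)\<^sup>2 * (norm r)\<^sup>2" by (rule power_mult_distrib)
  also have "\<dots> < ((1 + Bs)\<^sup>2 + (2 * (1 + Bs) * (1 + Bm) + (1 + Bm)\<^sup>2) * \<rho>\<^sup>2) * (norm r)\<^sup>2"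
    using num[OF \<rho>] nr by (intro mult_strict_right_mono) auto
  also note w_ge
  finally have lt: "Ds * norm r + Dm * norm c < norm w"
    by (rule power2_less_imp_less) simp
  moreover have "0 \<le> Ds * norm r + Dm * norm c" using nn by simp
  ultimately have "norm w > 0" by linarith
  with le have "norm w \<le> Ds * norm r + Dm * norm c" by simp
  with lt show False by simp
qed

text \<open>The slopes come from a numerical optimisation, and the second components are rounded up
  to multiples of \<open>1/50\<close>. All chains below share their lower part, and differ in the tangent point of
  the topmost step only, which is why each of the following pairs is one step away from this list.\<close>

lemma chain_bound_prefix:
  "chain_bound 1 (1/2) (1/2)" "chain_bound 2 (7/8) (57/50)" "chain_bound 3 (5/4) (91/50)"
  "chain_bound 4 (8/5) (64/25)" "chain_bound 5 (9/5) (169/50)" "chain_bound 6 2 (21/5)"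
  "chain_bound 7 3 (259/50)"
proof -
  show 1: "chain_bound 1 (1/2) (1/2)" by (rule chain_bound.one)
  show 2: "chain_bound 2 (7/8) (57/50)"
    using chain_bound.step[OF 1, of "7/8" "57/50"] by (simp add: power2_eq_square numeral_eq_Suc)
  show 3: "chain_bound 3 (5/4) (91/50)"
    using chain_bound.step[OF 2, of "5/4" "91/50"] by (simp add: power2_eq_square)
  show 4: "chain_bound 4 (8/5) (64/25)"
    using chain_bound.step[OF 3, of "8/5" "64/25"] by (simp add: power2_eq_square)
  show 5: "chain_bound 5 (9/5) (169/50)"
    using chain_bound.step[OF 4, of "9/5" "169/50"] by (simp add: power2_eq_square)
  show 6: "chain_bound 6 2 (21/5)"
    using chain_bound.step[OF 5, of "2" "21/5"] by (simp add: power2_eq_square)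
  show 7: "chain_bound 7 3 (259/50)"
    using chain_bound.step[OF 6, of "3" "259/50"] by (simp add: power2_eq_square)
qed

lemma chain_bound_side:
  "chain_bound 2 (4/3) (36/25)" "chain_bound 3 3 (163/50)" "chain_bound 4 8 (421/50)"
  using chain_bound.step[OF chain_bound_prefix(1), of "4/3" "36/25"]
    chain_bound.step[OF chain_bound_prefix(2), of "3" "163/50"]
    chain_bound.step[OF chain_bound_prefix(3), of "8" "421/50"]
  by (simp_all add: power2_eq_square eval_nat_numeral)

lemma chain_bound_main:
  "chain_bound 4 (19/10) (133/50)" "chain_bound 5 (5/2) (179/50)" "chain_bound 6 (16/5) (117/25)"
  "chain_bound 7 5 (34/5)" "chain_bound 8 (19/2) (286/25)"
  using chain_bound.step[OF chain_bound_prefix(3), of "19/10" "133/50"]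
    chain_bound.step[OF chain_bound_prefix(4), of "5/2" "179/50"]
    chain_bound.step[OF chain_bound_prefix(5), of "16/5" "117/25"]
    chain_bound.step[OF chain_bound_prefix(6), of "5" "34/5"]
    chain_bound.step[OF chain_bound_prefix(7), of "19/2" "286/25"]
  by (simp_all add: power2_eq_square)

text \<open>The difference of the two sides is a quadratic polynomial in \<open>x\<close> with negative discriminant.\<close>

lemma square_less_quadratic:
  fixes a b P K x :: real
  assumes "(a * b)\<^sup>2 < (P - a\<^sup>2) * (K - b\<^sup>2)" "b\<^sup>2 < K"
  shows "(a + b * x)\<^sup>2 < P + K * x\<^sup>2"
proof -
  define k where "k = K - b\<^sup>2"
  define q where "q = P - a\<^sup>2"
  have k: "k > 0" using assms(2) by (simp add: k_def)
  have "0 < (k * x - a * b)\<^sup>2 + (q * k - (a * b)\<^sup>2)"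
    using assms(1) unfolding k_def[symmetric] q_def[symmetric] by (intro add_nonneg_pos) auto
  also have "\<dots> = k * (q - 2 * a * b * x + k * x\<^sup>2)"
    by (simp add: power2_eq_square algebra_simps)
  finally have "0 < q - 2 * a * b * x + k * x\<^sup>2" using k by (simp add: zero_less_mult_iff)
  then show ?thesis by (simp add: k_def q_def power2_eq_square algebra_simps)
qed

text \<open>Together with \<open>r\<close> and \<open>c\<close> there are at most ten vectors. A rest of \<open>s \<le> 4\<close> elements leaves at most
  \<open>8 - s\<close> for \<open>M\<close>, hence five numerical cases.\<close>

lemma heavy_branch_contradiction:
  fixes r c :: "'a::real_inner"
  assumes T: "forest f r T" "card T \<le> 4" and M: "forest f c M" "card M + card T \<le> 8"
    and c: "c \<bullet> c \<le> c \<bullet> r" and r: "r \<noteq> 0"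
    and sum0: "r + c + (\<Sum>x\<in>T. x) + (\<Sum>x\<in>M. x) = 0"
  shows False
proof -
  consider "card T = 0" | "card T = 1" | "card T = 2" | "card T = 3" | "card T = 4"
    using T(2) by linarith
  then show False
  proof cases
    case 1
    show False
    proof (rule two_forest_contradiction[OF T(1) _ chain_bound.zero M(1) _ chain_bound_main(5) c r sum0])
      show "card T \<le> 0" "card M \<le> 8" using 1 M(2) by simp_all
    qed (rule square_less_quadratic; simp add: power2_eq_square)
  next
    case 2
    show False
    proof (rule two_forest_contradiction[OF T(1) _ chain_bound.one M(1) _ chain_bound_main(4) c r sum0])
      show "card T \<le> 1" "card M \<le> 7" using 2 M(2) by simp_all
    qed (rule square_less_quadratic; simp add: power2_eq_square)
  next
    case 3
    show False
    proof (rule two_forest_contradiction[OF T(1) _ chain_bound_side(1) M(1) _ chain_bound_main(3) c r sum0])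
      show "card T \<le> 2" "card M \<le> 6" using 3 M(2) by simp_all
    qed (rule square_less_quadratic; simp add: power2_eq_square)
  next
    case 4
    show False
    proof (rule two_forest_contradiction[OF T(1) _ chain_bound_side(2) M(1) _ chain_bound_main(2) c r sum0])
      show "card T \<le> 3" "card M \<le> 5" using 4 M(2) by simp_all
    qed (rule square_less_quadratic; simp add: power2_eq_square)
  next
    case 5
    show False
    proof (rule two_forest_contradiction[OF T(1) _ chain_bound_side(3) M(1) _ chain_bound_main(1) c r sum0])
      show "card T \<le> 4" "card M \<le> 4" using 5 M(2) by simp_all
    qed (rule square_less_quadratic; simp add: power2_eq_square)
  qed
qed

text \<open>The constant \<open>21/200\<close> comes from \<open>card S = 4\<close>, where \<open>D - B = 21/50\<close>. What matters is that it is
  less than \<open>1/9\<close>.\<close>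

lemma small_forest_bound:
  fixes r :: "'a::real_inner"
  assumes S: "forest f r S" "card S \<le> 4"
  shows "- (21/200) * real (card S) * (r \<bullet> r) \<le> (\<Sum>x\<in>S. r \<bullet> x)"
proof -
  have *: "- (21/200) * real (card S) * (r \<bullet> r) \<le> (\<Sum>x\<in>S. r \<bullet> x)"
    if "chain_bound (card S) B D" "D - B \<le> (21/200) * real (card S)" for B D
  proof -
    have "- (21/200) * real (card S) * (r \<bullet> r) \<le> (B - D) * (r \<bullet> r)"
      using that(2) by (intro mult_right_mono) auto
    also have "\<dots> = B * (r \<bullet> r) - D * norm r * norm r"
      using power2_norm_eq_inner[of r] by (simp add: left_diff_distrib power2_eq_square mult.assoc)
    also have "\<dots> \<le> (\<Sum>x\<in>S. r \<bullet> x)" by (rule forest_bound[OF S(1) order.refl that(1)])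
    finally show ?thesis .
  qed
  consider "card S = 0" | "card S = 1" | "card S = 2" | "card S = 3" | "card S = 4"
    using S(2) by linarith
  then show ?thesis
  proof cases
    case 1 then show ?thesis by (intro *[of 0 0]) (simp_all add: chain_bound.zero)
  next
    case 2 then show ?thesis using chain_bound.one by (intro *[of "1/2" "1/2"]) simp_all
  next
    case 3 then show ?thesis by (intro *[of "4/3" "36/25"]) (simp_all add: chain_bound_side)
  next
    case 4 then show ?thesis by (intro *[of 3 "163/50"]) (simp_all add: chain_bound_side)
  next
    case 5 then show ?thesis by (intro *[of 8 "421/50"]) (simp_all add: chain_bound_side)
  qed
qed

text \<open>Either some branch leaves at most four elements outside it, or all branches have at most four
  elements. In the second case the projection on \<open>r\<close> suffices: at most nine vectors cannot outweigh the
  root if each of them contributes at least \<open>- (21/200) * (r \<bullet> r)\<close> on average.\<close>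

theorem no_small_tree:
  fixes r :: "'a::real_inner"
  assumes F: "forest f r N" and rN: "r \<notin> N" and N: "card N \<le> 9" and r: "r \<noteq> 0"
    and sum0: "r + (\<Sum>x\<in>N. x) = 0"
  shows False
proof -
  have fin: "finite N" using F by (simp add: forest_def)
  obtain top where top: "\<And>x. x \<in> N \<Longrightarrow> top x \<in> N \<and> f (top x) = r"
    "\<And>x. x \<in> N \<Longrightarrow> f x = r \<Longrightarrow> top x = x"
    "\<And>x. x \<in> N \<Longrightarrow> f x \<noteq> r \<Longrightarrow> top x = top (f x)"
    using branch_function[OF F rN] by blast
  define C where "C = {c \<in> N. f c = r}"
  define S where "S = (\<lambda>c. {x \<in> N. top x = c})"
  have Sf: "forest f r (S c)" for c
    using F top unfolding forest_def S_def by auto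
  have S_rest: "forest f r (N - S c)" for c
    using F top unfolding forest_def S_def by auto
  have Sc: "forest f c (S c - {c})" if "c \<in> C" for c
  proof -
    have "f x \<in> insert c (S c - {c})" if x: "x \<in> S c - {c}" for x
    proof -
      have xN: "x \<in> N" and tx: "top x = c" "x \<noteq> c" using x by (auto simp: S_def)
      then have "f x \<noteq> r" using top(2) by auto
      moreover have "f x \<in> insert r N" using F xN by (auto simp: forest_def)
      ultimately show ?thesis using top(3)[OF xN] tx by (auto simp: S_def)
    qed
    then show ?thesis using F by (auto simp: forest_def S_def)
  qed
  show False
  proof (cases "\<exists>c\<in>C. card (N - S c) \<le> 4")
    case True
    then obtain c where c: "c \<in> C" "card (N - S c) \<le> 4" by blast
    have cS: "c \<in> S c" using c top by (auto simp: C_def S_def)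
    have SN: "S c \<subseteq> N" by (auto simp: S_def)
    have "card N = card (N - S c) + card (S c)"
      using fin SN by (metis add.commute card_Diff_subset card_mono finite_subset le_add_diff_inverse)
    moreover have "card (S c) = Suc (card (S c - {c}))"
      using cS fin SN by (metis card.remove finite_subset)
    ultimately have card: "card (S c - {c}) + card (N - S c) \<le> 8" using N by linarith
    have "(\<Sum>x\<in>N. x) = (\<Sum>x\<in>N - S c. x) + (\<Sum>x\<in>S c. x)"
      using fin SN by (metis sum.subset_diff)
    also have "(\<Sum>x\<in>S c. x) = c + (\<Sum>x\<in>S c - {c}. x)"
      using cS fin SN by (metis sum.remove finite_subset)
    finally have "r + c + (\<Sum>x\<in>N - S c. x) + (\<Sum>x\<in>S c - {c}. x) = 0"
      using sum0 by (simp add: algebra_simps)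
    moreover have "c \<bullet> c \<le> c \<bullet> r" using c F by (auto simp: C_def forest_def)
    ultimately show False
      using heavy_branch_contradiction[OF S_rest c(2) Sc[OF c(1)] card] r by blast
  next
    case False
    have rr: "r \<bullet> r > 0" using r by simp
    have small: "card (S c) \<le> 4" if "c \<in> C" for c
    proof -
      have "card (N - S c) = card N - card (S c)"
        using fin by (intro card_Diff_subset) (auto simp: S_def)
      with False that N show ?thesis by force
    qed
    have part: "(\<Sum>x\<in>N. g x) = (\<Sum>c\<in>C. \<Sum>x\<in>S c. g x)" for g :: "'a \<Rightarrow> real"
      unfolding S_def using fin top by (intro sum.group[symmetric]) (auto simp: C_def)
    have "- (21/200) * real (card N) * (r \<bullet> r) = (\<Sum>c\<in>C. - (21/200) * real (card (S c)) * (r \<bullet> r))"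
      using part[of "\<lambda>_. - (21/200) * (r \<bullet> r)"] by (simp add: algebra_simps)
    also have "\<dots> \<le> (\<Sum>c\<in>C. \<Sum>x\<in>S c. r \<bullet> x)"
      by (intro sum_mono small_forest_bound[OF Sf small])
    also have "\<dots> = (\<Sum>x\<in>N. r \<bullet> x)" by (rule part[symmetric])
    also have "\<dots> = r \<bullet> (- r)"
    proof -
      have "(\<Sum>x\<in>N. x) = - r" using sum0 by (simp add: add_eq_0_iff)
      then show ?thesis by (simp flip: inner_sum_right)
    qed
    finally have "r \<bullet> r \<le> (21/200) * real (card N) * (r \<bullet> r)" by simp
    also have "\<dots> \<le> (21/200) * 9 * (r \<bullet> r)" using N rr by (intro mult_right_mono mult_left_mono) auto
    finally show False using rr by simp
  qed
qed

section \<open>Vertices and facets of three-dimensional polytopes\<close>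

text \<open>The functionals that agree at two given points form a hyperplane, and finitely many hyperplanes
  do not cover the space.\<close>

lemma exists_injective_functional:
  fixes X :: "'a::euclidean_space set"
  assumes "finite X"
  shows "\<exists>l. inj_on (\<lambda>x. l \<bullet> x) X"
proof -
  define U where "U = (\<Union>(x,y)\<in>{(x,y). x \<in> X \<and> y \<in> X \<and> x \<noteq> y}. {l. (x - y) \<bullet> l = 0})"
  have "finite {(x,y). x \<in> X \<and> y \<in> X \<and> x \<noteq> y}"
    by (rule finite_subset[OF _ finite_cartesian_product[OF assms assms]]) auto
  then have "negligible U" unfolding U_def
    by (intro negligible_Union) (auto intro!: negligible_hyperplane)
  then have "U \<noteq> UNIV" by (metis non_negligible_UNIV)
  then obtain l where "l \<notin> U" by auto
  have "inj_on (\<lambda>x. l \<bullet> x) X"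
  proof (rule inj_onI)
    fix x y assume xy: "x \<in> X" "y \<in> X" "l \<bullet> x = l \<bullet> y"
    then have "(x - y) \<bullet> l = 0" by (subst inner_commute) (simp add: inner_diff_right)
    then show "x = y" using \<open>l \<notin> U\<close> xy by (auto simp: U_def)
  qed
  then show ?thesis ..
qed

lemma polytope_vertices_finite: "polytope P \<Longrightarrow> finite (polytope_vertices P)"
  unfolding polytope_vertices_def using finite_polyhedron_extreme_points polytope_imp_polyhedron by blast

lemma polytope_eq_hull_vertices: "polytope P \<Longrightarrow> P = convex hull (polytope_vertices P)"
  unfolding polytope_vertices_def
  by (intro Krein_Milman_Minkowski polytope_imp_compact polytope_imp_convex)

lemma face_vertices:
  assumes "F face_of P" shows "polytope_vertices F = polytope_vertices P \<inter> F"
  using extreme_point_of_face[OF assms] by (auto simp: polytope_vertices_def)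

text \<open>Two different facets meet in a face of dimension at most one. Were the functional constant on
  an edge, it would take the same value at both ends of it. Hence a level set of an injective
  functional through \<open>v\<close> meets the two facets in segments with only \<open>v\<close> in common.\<close>

lemma two_facets_transversal:
  fixes P :: "'a::euclidean_space set"
  assumes P: "polytope P" "aff_dim P = 3" and FG: "F facet_of P" "G facet_of P" "F \<noteq> G"
    and inj: "inj_on (\<lambda>x. l \<bullet> x) (polytope_vertices P)"
    and v: "v \<in> F \<inter> G" and p: "p \<in> F \<inter> G" and eq: "l \<bullet> p = l \<bullet> v"
  shows "p = v"
proof (rule ccontr)
  assume "p \<noteq> v"
  have Ff: "F face_of P" "G face_of P" and dF: "aff_dim F = 2" "aff_dim G = 2"
    using FG P by (auto simp: facet_of_def)
  have FGf: "F \<inter> G face_of P" using Ff by (rule face_of_Int)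
  have cvx: "convex F" "convex G" using Ff face_of_imp_convex by blast+
  have FGF: "F \<inter> G face_of F"
    using FGf Ff by (meson face_of_subset face_of_imp_subset inf_le1)
  have "F \<inter> G \<noteq> F"
  proof
    assume "F \<inter> G = F"
    then have "F face_of G" using Ff by (metis face_of_subset face_of_imp_subset inf_le2)
    then show False using FG(3) dF face_of_aff_dim_lt[OF cvx(2)] by fastforce
  qed
  then have "aff_dim (F \<inter> G) < 2" using face_of_aff_dim_lt[OF cvx(1) FGF] dF by simp
  moreover have "aff_dim {v, p} = 1" using \<open>p \<noteq> v\<close> by (simp add: aff_dim_2)
  moreover have sub: "{v, p} \<subseteq> F \<inter> G" using v p by auto
  ultimately have "aff_dim {v, p} = aff_dim (F \<inter> G)" using aff_dim_subset[OF sub] by linarith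
  then have "affine hull {v, p} = affine hull (F \<inter> G)" using aff_dim_eq_full_gen[OF sub] by blast
  then have line: "x \<in> affine hull {v, p}" if "x \<in> F \<inter> G" for x
    using hull_subset[of "F \<inter> G" affine] that by auto
  have const: "l \<bullet> x = l \<bullet> v" if x: "x \<in> F \<inter> G" for x
  proof -
    obtain a b where "a + b = 1" "x = a *\<^sub>R v + b *\<^sub>R p"
      using line[OF x] by (auto simp: affine_hull_2)
    then show ?thesis using eq by (simp add: inner_add_right flip: distrib_right)
  qed
  have pFG: "polytope (F \<inter> G)" using FGf P(1) by (rule face_of_polytope_polytope[rotated])
  have "x = y" if "x \<in> polytope_vertices (F \<inter> G)" "y \<in> polytope_vertices (F \<inter> G)" for x y
    using that inj const unfolding face_vertices[OF FGf] inj_on_def by force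
  then obtain a where "polytope_vertices (F \<inter> G) \<subseteq> {a}" by blast
  then have "F \<inter> G \<subseteq> {a}"
    using polytope_eq_hull_vertices[OF pFG] by (metis convex_hull_singleton hull_mono)
  then show False using v p \<open>p \<noteq> v\<close> by auto
qed

text \<open>Take a facet \<open>F1\<close> through \<open>v\<close> and an edge \<open>E\<close> of it through \<open>v\<close>. As faces are intersections of
  facets, a second facet cuts \<open>F1\<close> down to \<open>E\<close>, and a third one cuts \<open>E\<close> down to \<open>v\<close>.\<close>

lemma vertex_three_facets:
  fixes P :: "'a::euclidean_space set"
  assumes P: "polytope P" "aff_dim P = 3" and v: "v extreme_point_of P"
  obtains F1 F2 F3 where "F1 facet_of P" "F2 facet_of P" "F3 facet_of P" "v \<in> F1" "v \<in> F2" "v \<in> F3"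
    "F1 \<noteq> F2" "F1 \<noteq> F3" "F2 \<noteq> F3"
proof -
  have ph: "polyhedron P" using P(1) by (rule polytope_imp_polyhedron)
  have vf: "{v} face_of P" using v by (simp add: face_of_singleton)
  have vP: "{v} \<noteq> P" using P(2) by auto
  obtain F1 where F1: "F1 facet_of P" "{v} \<subseteq> F1"
    using face_of_polyhedron_subset_facet[OF ph vf _ vP] by auto
  have F1f: "F1 face_of P" and d1: "aff_dim F1 = 2" using F1 P by (auto simp: facet_of_def)
  have ph1: "polyhedron F1" using face_of_polyhedron_polyhedron[OF ph F1f] .
  have vf1: "{v} face_of F1" using vf F1 F1f by (meson face_of_subset face_of_imp_subset)
  have vF1: "{v} \<noteq> F1" using d1 by auto
  obtain E where E: "E facet_of F1" "{v} \<subseteq> E"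
    using face_of_polyhedron_subset_facet[OF ph1 vf1 _ vF1] by auto
  have dE: "aff_dim E = 1" and EF1: "E face_of F1" using E d1 by (auto simp: facet_of_def)
  have EP: "E face_of P" using EF1 F1f by (rule face_of_trans)
  have "E = \<Inter>{F. F facet_of P \<and> E \<subseteq> F}"
    using E dE P(2) by (intro face_of_polyhedron[OF ph EP]) auto
  moreover have "E \<noteq> F1" "E \<subseteq> F1" using dE d1 EF1 face_of_imp_subset by auto
  ultimately obtain F2 where F2: "F2 facet_of P" "E \<subseteq> F2" "F2 \<noteq> F1"
    using F1(1) by blast
  have "{v} = \<Inter>{F. F facet_of P \<and> {v} \<subseteq> F}"
    by (rule face_of_polyhedron[OF ph vf _ vP]) simp
  moreover have "E \<noteq> {v}" using dE by auto
  ultimately have "\<not> E \<subseteq> \<Inter>{F. F facet_of P \<and> {v} \<subseteq> F}" using E(2) by (metis subset_antisym)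
  then obtain F3 where F3: "F3 facet_of P" "v \<in> F3" "\<not> E \<subseteq> F3" by blast
  show thesis using that[OF F1(1) F2(1) F3(1)] F1 F2 F3 E \<open>E \<subseteq> F1\<close> by auto
qed

text \<open>Suppose that \<open>l\<close> takes values on both sides of \<open>l \<bullet> v\<close> on every facet through \<open>v\<close>. Then the
  plane \<open>l \<bullet> x = l \<bullet> v\<close> meets each of three such facets in a segment starting at \<open>v\<close>. The section of
  \<open>P\<close> by that plane is two-dimensional and has \<open>v\<close> as a corner, so the middle one of the three
  directions is a nonnegative combination of the other two; as it lies in a supporting plane of \<open>P\<close>,
  one of the others lies in the same facet, which \<open>two_facets_transversal\<close> excludes.\<close>

lemma vertex_extremal_in_facet:
  fixes P :: "'a::euclidean_space set"
  assumes dim: "DIM('a) = 3" and P: "polytope P" "aff_dim P = 3" and v: "v extreme_point_of P"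
    and inj: "inj_on (\<lambda>x. l \<bullet> x) (polytope_vertices P)"
  shows "\<exists>F. F facet_of P \<and> v \<in> F \<and>
    ((\<forall>w\<in>polytope_vertices F. l \<bullet> v \<le> l \<bullet> w) \<or> (\<forall>w\<in>polytope_vertices F. l \<bullet> w \<le> l \<bullet> v))"
proof (rule ccontr)
  assume neg: "\<not> ?thesis"
  have ph: "polyhedron P" using P(1) by (rule polytope_imp_polyhedron)
  define good where "good = (\<lambda>F p. F facet_of P \<and> v \<in> F \<and> p \<in> F \<and> p \<noteq> v \<and> l \<bullet> p = l \<bullet> v)"
  have good_P: "p \<in> P" if "good F p" for F p
    using that facet_of_imp_subset unfolding good_def by blast
  have slice: "\<exists>p. good F p" if F: "F facet_of P" "v \<in> F" for F
  proof -
    obtain w1 w2 where w: "w1 \<in> polytope_vertices F" "l \<bullet> w1 < l \<bullet> v"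
      "w2 \<in> polytope_vertices F" "l \<bullet> v < l \<bullet> w2"
      using neg F by (meson not_le)
    have wF: "w1 \<in> F" "w2 \<in> F" using w by (auto simp: polytope_vertices_def extreme_point_of_def)
    have Ff: "F face_of P" using F by (simp add: facet_of_def)
    define u where "u = (l \<bullet> v - l \<bullet> w1) / (l \<bullet> w2 - l \<bullet> w1)"
    have u: "0 < u" "u < 1" using w by (auto simp: u_def)
    define p where "p = (1 - u) *\<^sub>R w1 + u *\<^sub>R w2"
    have "w1 \<noteq> w2" using w by auto
    then have "p \<in> open_segment w1 w2" using u by (auto simp: p_def in_segment)
    then have "p \<noteq> v" using v wF face_of_imp_subset[OF Ff] unfolding extreme_point_of_def by blast
    moreover have "p \<in> F"
      unfolding p_def using face_of_imp_convex[OF Ff] wF u by (intro convexD) auto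
    moreover have "l \<bullet> p = l \<bullet> w1 + u * (l \<bullet> w2 - l \<bullet> w1)"
      by (simp add: p_def inner_add_right algebra_simps)
    then have "l \<bullet> p = l \<bullet> v" using w by (simp add: u_def)
    ultimately show ?thesis using F by (auto simp: good_def)
  qed
  have "{v} exposed_face_of P" using v exposed_face_of_polyhedron[OF ph] by (simp add: face_of_singleton)
  then obtain h b where hb: "P \<subseteq> {x. h \<bullet> x \<le> b}" "{v} = P \<inter> {x. h \<bullet> x = b}"
    unfolding exposed_face_of_def by auto
  have hneg: "h \<bullet> (p - v) < 0" if "good F p" for F p
  proof -
    have "p \<in> P" "p \<noteq> v" using that good_P by (auto simp: good_def)
    then have "h \<bullet> p \<le> b" "h \<bullet> p \<noteq> b" "h \<bullet> v = b" using hb by blast+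
    then show ?thesis by (simp add: inner_diff_right)
  qed
  \<comment> \<open>the directions into the section lie in an open half-plane because the corner \<open>v\<close> is exposed\<close>
  have pointed: "a = 0 \<and> b = 0 \<and> c = 0"
    if "good F p" "good G q" "good H s" "0 \<le> a" "0 \<le> b" "0 \<le> c"
      "a *\<^sub>R (p - v) + b *\<^sub>R (q - v) + c *\<^sub>R (s - v) = 0" for F G H p q s a b c
  proof -
    have "a * (h \<bullet> (p - v)) + b * (h \<bullet> (q - v)) + c * (h \<bullet> (s - v)) = 0"
      using arg_cong[OF that(7), of "\<lambda>x. h \<bullet> x"] by (simp only: inner_add_right inner_scaleR_right inner_zero_right)
    moreover have "a * (h \<bullet> (p - v)) \<le> 0" "b * (h \<bullet> (q - v)) \<le> 0" "c * (h \<bullet> (s - v)) \<le> 0"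
      using that by (auto intro!: mult_nonneg_nonpos less_imp_le[OF hneg])
    ultimately have "a * (h \<bullet> (p - v)) = 0" "b * (h \<bullet> (q - v)) = 0" "c * (h \<bullet> (s - v)) = 0"
      by linarith+
    then show ?thesis using hneg[OF that(1)] hneg[OF that(2)] hneg[OF that(3)] by auto
  qed
  have transversal: "q \<notin> F" if "good F p" "good G q" "F \<noteq> G" for F G p q
    using two_facets_transversal[OF P _ _ that(3) inj, of v q] that by (auto simp: good_def)
  \<comment> \<open>\<open>p - v\<close> cannot be the middle direction\<close>
  have middle: False
    if g: "good F p" "good G q" "good H s" "F \<noteq> G" "F \<noteq> H" and abc: "a < 0" "0 \<le> b" "0 \<le> c"
      and rel: "a *\<^sub>R (p - v) + b *\<^sub>R (q - v) + c *\<^sub>R (s - v) = 0" for F G H p q s a b c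
  proof -
    have "F exposed_face_of P"
      using g(1) exposed_face_of_polyhedron[OF ph] by (simp add: good_def facet_of_def)
    then obtain n t where nt: "P \<subseteq> {x. n \<bullet> x \<le> t}" "F = P \<inter> {x. n \<bullet> x = t}"
      unfolding exposed_face_of_def by auto
    have "n \<bullet> p = t" "n \<bullet> v = t" using g(1) nt by (auto simp: good_def)
    have "n \<bullet> q \<le> t" "n \<bullet> s \<le> t" using g nt good_P by blast+
    moreover have "n \<bullet> q \<noteq> t" using transversal[OF g(1,2,4)] good_P[OF g(2)] nt by auto
    moreover have "n \<bullet> s \<noteq> t" using transversal[OF g(1,3,5)] good_P[OF g(3)] nt by auto
    ultimately have lt: "n \<bullet> q - t < 0" "n \<bullet> s - t < 0" by auto
    have "b * (n \<bullet> q - t) + c * (n \<bullet> s - t) = 0"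
      using arg_cong[OF rel, of "\<lambda>x. n \<bullet> x"] \<open>n \<bullet> p = t\<close> \<open>n \<bullet> v = t\<close>
      by (simp add: inner_add_right inner_diff_right)
    moreover have "b * (n \<bullet> q - t) \<le> 0" "c * (n \<bullet> s - t) \<le> 0"
      using abc lt by (simp_all add: mult_nonneg_nonpos)
    ultimately have "b * (n \<bullet> q - t) = 0" "c * (n \<bullet> s - t) = 0" by linarith+
    then have "b = 0" "c = 0" using lt by auto
    with rel abc g(1) show False by (auto simp: good_def)
  qed
  obtain F1 F2 F3 where F: "F1 facet_of P" "F2 facet_of P" "F3 facet_of P" "v \<in> F1" "v \<in> F2" "v \<in> F3"
    "F1 \<noteq> F2" "F1 \<noteq> F3" "F2 \<noteq> F3"
    using vertex_three_facets[OF P v] by metis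
  obtain p1 p2 p3 where p: "good F1 p1" "good F2 p2" "good F3 p3"
    using slice F by meson
  have pd: "p1 \<noteq> p2" "p1 \<noteq> p3" "p2 \<noteq> p3"
    using transversal[OF p(1,2)] transversal[OF p(1,3)] transversal[OF p(2,3)] F p
    by (auto simp: good_def)
  obtain w where "l \<bullet> w \<noteq> l \<bullet> v"
    using neg F by (metis order.refl)
  then have l0: "l \<noteq> 0" by auto
  define Q where "Q = {p1 - v, p2 - v, p3 - v}"
  have cardQ: "card Q = 3" using pd by (simp add: Q_def)
  have "Q \<subseteq> {x. l \<bullet> x = 0}" using p by (auto simp: Q_def good_def inner_diff_right)
  then have "dependent Q"
    using independent_card_le_dim[of Q "{x. l \<bullet> x = 0}"] dim_hyperplane[OF l0] cardQ dim by auto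
  then obtain u where u: "\<exists>x\<in>Q. u x \<noteq> 0" "(\<Sum>x\<in>Q. u x *\<^sub>R x) = 0"
    using dependent_finite[of Q] by (auto simp: Q_def)
  define a b c where "a = u (p1 - v)" and "b = u (p2 - v)" and "c = u (p3 - v)"
  have nz: "\<not> (a = 0 \<and> b = 0 \<and> c = 0)" using u(1) by (auto simp: Q_def a_def b_def c_def)
  have rel: "a *\<^sub>R (p1 - v) + b *\<^sub>R (p2 - v) + c *\<^sub>R (p3 - v) = 0"
    using u(2) pd by (simp add: Q_def a_def b_def c_def add.assoc)
  have rel2: "b *\<^sub>R (p2 - v) + a *\<^sub>R (p1 - v) + c *\<^sub>R (p3 - v) = 0"
    and rel3: "c *\<^sub>R (p3 - v) + a *\<^sub>R (p1 - v) + b *\<^sub>R (p2 - v) = 0"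
    using rel by (simp_all add: add_ac)
  have mrel: "(- a) *\<^sub>R (p1 - v) + (- b) *\<^sub>R (p2 - v) + (- c) *\<^sub>R (p3 - v) = 0"
    and mrel2: "(- b) *\<^sub>R (p2 - v) + (- a) *\<^sub>R (p1 - v) + (- c) *\<^sub>R (p3 - v) = 0"
    and mrel3: "(- c) *\<^sub>R (p3 - v) + (- a) *\<^sub>R (p1 - v) + (- b) *\<^sub>R (p2 - v) = 0"
    using arg_cong[OF rel, of uminus] arg_cong[OF rel2, of uminus] arg_cong[OF rel3, of uminus]
    by (simp_all only: minus_add_distrib scaleR_minus_left minus_zero add.commute add.left_commute)
  \<comment> \<open>the signs of a linear relation single out the middle direction, up to a change of sign\<close>
  note F' = F(7-9) F(7-9)[symmetric]
  consider "0 \<le> a \<and> 0 \<le> b \<and> 0 \<le> c" | "a \<le> 0 \<and> b \<le> 0 \<and> c \<le> 0"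
    | "a < 0 \<and> 0 \<le> b \<and> 0 \<le> c" | "b < 0 \<and> 0 \<le> a \<and> 0 \<le> c" | "c < 0 \<and> 0 \<le> a \<and> 0 \<le> b"
    | "0 < a \<and> b \<le> 0 \<and> c \<le> 0" | "0 < b \<and> a \<le> 0 \<and> c \<le> 0" | "0 < c \<and> a \<le> 0 \<and> b \<le> 0"
    by linarith
  then show False
  proof cases
    case 1 then show False using pointed[OF p, of a b c] rel nz by blast
  next
    case 2 then show False using pointed[OF p, of "-a" "-b" "-c"] mrel nz by auto
  next
    case 3 then show False using middle[OF p(1,2,3), of a b c] rel F' by blast
  next
    case 4 then show False using middle[OF p(2,1,3), of b a c] rel2 F' by blast
  next
    case 5 then show False using middle[OF p(3,1,2), of c a b] rel3 F' by blast
  next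
    case 6 then show False using middle[OF p(1,2,3), of "-a" "-b" "-c"] mrel F' by auto
  next
    case 7 then show False using middle[OF p(2,1,3), of "-b" "-a" "-c"] mrel2 F' by auto
  next
    case 8 then show False using middle[OF p(3,1,2), of "-c" "-a" "-b"] mrel3 F' by auto
  qed
qed

text \<open>The inequality \<open>V \<le> 2 * F - 4\<close>, without Euler's formula. Sweep \<open>P\<close> by an injective functional:
  every facet has one lowest and one highest vertex, every vertex is lowest or highest in at least one
  of its facets, and the two extreme vertices of \<open>P\<close> are so in at least three.\<close>

theorem vertices_le_facets:
  fixes P :: "'a::euclidean_space set"
  assumes dim: "DIM('a) = 3" and P: "polytope P" "aff_dim P = 3"
  shows "card (polytope_vertices P) + 4 \<le> 2 * card {F. F facet_of P}"
proof -
  let ?V = "polytope_vertices P" and ?Fs = "{F. F facet_of P}"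
  have finV: "finite ?V" using P(1) by (rule polytope_vertices_finite)
  have finF: "finite ?Fs"
    by (rule finite_polyhedron_facets[OF polytope_imp_polyhedron[OF P(1)]])
  obtain l where inj: "inj_on (\<lambda>x. l \<bullet> x) ?V" using exists_injective_functional[OF finV] by blast
  have ne: "?V \<noteq> {}"
    using polytope_eq_hull_vertices[OF P(1)] P(2) by (metis aff_dim_empty convex_hull_empty numeral_neq_neg_one)
  have vF: "w \<in> ?V" if "F facet_of P" "w \<in> polytope_vertices F" for F w
    using that face_vertices by (auto simp: facet_of_def)
  have vF': "w \<in> polytope_vertices F" if "F facet_of P" "w \<in> ?V" "w \<in> F" for F w
    using that face_vertices by (auto simp: facet_of_def)
  define lo where "lo = arg_min_on (\<lambda>x. l \<bullet> x) ?V"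
  define hi where "hi = arg_min_on (\<lambda>x. - (l \<bullet> x)) ?V"
  have lo: "lo \<in> ?V" "\<And>w. w \<in> ?V \<Longrightarrow> l \<bullet> lo \<le> l \<bullet> w"
    using arg_min_if_finite(1)[OF finV ne, of "\<lambda>x. l \<bullet> x"] arg_min_least[OF finV ne, of _ "\<lambda>x. l \<bullet> x"]
    by (auto simp: lo_def)
  have hi: "hi \<in> ?V" "\<And>w. w \<in> ?V \<Longrightarrow> l \<bullet> w \<le> l \<bullet> hi"
    using arg_min_if_finite(1)[OF finV ne, of "\<lambda>x. - (l \<bullet> x)"]
      arg_min_least[OF finV ne, of _ "\<lambda>x. - (l \<bullet> x)"]
    by (auto simp: hi_def)
  have "lo \<noteq> hi"
  proof
    assume "lo = hi"
    then have "?V \<subseteq> {lo}" using lo hi inj unfolding inj_on_def by (metis order_antisym singletonI subsetI)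
    then have "P \<subseteq> {lo}"
      using polytope_eq_hull_vertices[OF P(1)] by (metis convex_hull_singleton hull_mono)
    then show False using aff_dim_subset[of P "{lo}"] P(2) by simp
  qed
  define A where "A = (\<lambda>v. {F. F facet_of P \<and> v \<in> F \<and> (\<forall>w\<in>polytope_vertices F. l \<bullet> v \<le> l \<bullet> w)})"
  define B where "B = (\<lambda>v. {F. F facet_of P \<and> v \<in> F \<and> (\<forall>w\<in>polytope_vertices F. l \<bullet> w \<le> l \<bullet> v)})"
  have finA: "finite (A v)" and finB: "finite (B v)" for v
    using finF by (auto simp: A_def B_def intro: finite_subset)
  have disjA: "A v \<inter> A w = {}" if "v \<in> ?V" "w \<in> ?V" "v \<noteq> w" for v w
    using vF'[OF _ that(1)] vF'[OF _ that(2)] inj_onD[OF inj _ that(1,2)] that(3)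
    unfolding A_def by (blast intro: order_antisym)
  have disjB: "B v \<inter> B w = {}" if "v \<in> ?V" "w \<in> ?V" "v \<noteq> w" for v w
    using vF'[OF _ that(1)] vF'[OF _ that(2)] inj_onD[OF inj _ that(1,2)] that(3)
    unfolding B_def by (blast intro: order_antisym)
  have sumA: "(\<Sum>v\<in>?V. card (A v)) \<le> card ?Fs"
  proof -
    have "(\<Sum>v\<in>?V. card (A v)) = card (\<Union>v\<in>?V. A v)"
      using finV finA disjA by (intro card_UN_disjoint[symmetric]) auto
    also have "\<dots> \<le> card ?Fs" using finF by (intro card_mono) (auto simp: A_def)
    finally show ?thesis .
  qed
  have sumB: "(\<Sum>v\<in>?V. card (B v)) \<le> card ?Fs"
  proof -
    have "(\<Sum>v\<in>?V. card (B v)) = card (\<Union>v\<in>?V. B v)"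
      using finV finB disjB by (intro card_UN_disjoint[symmetric]) auto
    also have "\<dots> \<le> card ?Fs" using finF by (intro card_mono) (auto simp: B_def)
    finally show ?thesis .
  qed
  have three: "3 \<le> card X" if "finite X" "\<And>F. F facet_of P \<Longrightarrow> v \<in> F \<Longrightarrow> F \<in> X" "v \<in> ?V" for X v
  proof -
    have "v extreme_point_of P" using that(3) by (simp add: polytope_vertices_def)
    then obtain F1 F2 F3 where F: "F1 facet_of P" "F2 facet_of P" "F3 facet_of P"
      "v \<in> F1" "v \<in> F2" "v \<in> F3" "F1 \<noteq> F2" "F1 \<noteq> F3" "F2 \<noteq> F3"
      using vertex_three_facets[OF P] by metis
    then have "{F1, F2, F3} \<subseteq> X" using that(2) by blast
    then have "card {F1, F2, F3} \<le> card X" using that(1) by (rule card_mono[rotated])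
    then show ?thesis using F by simp
  qed
  have Alo: "3 \<le> card (A lo)"
    using finA lo vF by (intro three[of _ lo]) (auto simp: A_def)
  have Bhi: "3 \<le> card (B hi)"
    using finB hi vF by (intro three[of _ hi]) (auto simp: B_def)
  have AB: "1 \<le> card (A v) + card (B v)" if "v \<in> ?V" for v
  proof -
    have "A v \<union> B v \<noteq> {}"
      using vertex_extremal_in_facet[OF dim P _ inj, of v] that
      unfolding A_def B_def polytope_vertices_def by blast
    then show ?thesis using finA[of v] finB[of v] by (auto simp: Suc_le_eq card_gt_0_iff)
  qed
  have pw: "1 + (if v = lo then 2 else 0) + (if v = hi then 2 else 0) \<le> card (A v) + card (B v)"
    if "v \<in> ?V" for v
    using AB[OF that] Alo Bhi \<open>lo \<noteq> hi\<close> by auto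
  have "(\<Sum>v\<in>?V. 1 + (if v = lo then 2 else 0) + (if v = hi then 2 else 0)) = card ?V + 4"
    using finV lo(1) hi(1) by (simp only: sum.distrib sum.delta) simp
  moreover have "(\<Sum>v\<in>?V. 1 + (if v = lo then 2 else 0) + (if v = hi then 2 else 0))
      \<le> (\<Sum>v\<in>?V. card (A v) + card (B v))" by (rule sum_mono[OF pw])
  ultimately show ?thesis using sumA sumB by (simp add: sum.distrib)
qed

section \<open>Equilibria and the tree of vertices\<close>

lemma center_in_polytope:
  fixes P :: "'a::euclidean_space set"
  assumes P: "polytope P" "P \<noteq> {}"
  shows "center_of_mass0 P \<in> P"
proof -
  let ?V = "polytope_vertices P"
  have fin: "finite ?V" using P(1) by (rule polytope_vertices_finite)
  have ne: "?V \<noteq> {}" using polytope_eq_hull_vertices[OF P(1)] P(2) by auto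
  have "(\<Sum>v\<in>?V. (1 / real (card ?V)) *\<^sub>R v) \<in> P"
    using fin ne polytope_imp_convex[OF P(1)]
    by (intro convex_sum) (auto simp: polytope_vertices_def extreme_point_of_def card_gt_0_iff)
  then show ?thesis by (simp add: center_of_mass0_def scaleR_right.sum)
qed

text \<open>The condition for an unstable equilibrium need only be tested at the vertices: equality in the
  supporting inequality holds on a face, and a face with a single vertex is that vertex.\<close>

lemma unstable_equilibrium_iff:
  fixes P :: "'a::euclidean_space set"
  assumes P: "polytope P" "0 < aff_dim P" and g: "g \<in> P"
  shows "unstable_equilibrium P g q \<longleftrightarrow>
    q \<in> polytope_vertices P \<and> (\<forall>x\<in>polytope_vertices P - {q}. (q - g) \<bullet> (x - q) < 0)"
    (is "?L \<longleftrightarrow> ?R")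
proof
  assume L: ?L
  let ?H = "perp_hyperplane g q \<inter> P"
  have q: "q \<in> P" and side: "(\<forall>x\<in>P. (q - g) \<bullet> (x - q) \<le> 0) \<or> (\<forall>x\<in>P. (q - g) \<bullet> (x - q) \<ge> 0)"
    and dim: "aff_dim ?H = 0" and face: "?H face_of P"
    using L unfolding unstable_equilibrium_def nondegenerate_equilibrium_def equilibrium_point_def
    by blast+
  have "q \<in> ?H" using q by (simp add: perp_hyperplane_def)
  moreover obtain a where "?H = {a}" using dim aff_dim_eq_0[of ?H] by auto
  ultimately have H: "?H = {q}" by auto
  then have ext: "q extreme_point_of P" using face by (simp add: face_of_singleton)
  have "q \<noteq> g"
  proof
    assume "q = g"
    then have "?H = P" by (simp add: perp_hyperplane_def)
    then show False using dim P(2) by simp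
  qed
  then have "(q - g) \<bullet> (g - q) < 0"
    by (metis inner_gt_zero_iff inner_minus_right minus_diff_eq neg_less_0_iff_less right_minus_eq)
  then have le: "\<forall>x\<in>P. (q - g) \<bullet> (x - q) \<le> 0" using side g by (meson not_less)
  have "(q - g) \<bullet> (x - q) < 0" if "x \<in> P" "x \<noteq> q" for x
  proof -
    have "x \<notin> ?H" using H that(2) by blast
    then have "(q - g) \<bullet> (x - q) \<noteq> 0" using that(1) by (simp add: perp_hyperplane_def)
    then show ?thesis using le that(1) by (meson order_le_less)
  qed
  then show ?R using ext by (auto simp: polytope_vertices_def extreme_point_of_def)
next
  assume R: ?R
  let ?H = "perp_hyperplane g q \<inter> P"
  have ext: "q extreme_point_of P" and qV: "q \<in> polytope_vertices P"
    using R by (auto simp: polytope_vertices_def)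
  then have qP: "q \<in> P" by (simp add: extreme_point_of_def)
  have "polytope_vertices P \<subseteq> {x. (q - g) \<bullet> x \<le> (q - g) \<bullet> q}"
  proof
    fix x assume x: "x \<in> polytope_vertices P"
    show "x \<in> {x. (q - g) \<bullet> x \<le> (q - g) \<bullet> q}"
    proof (cases "x = q")
      case False
      with x R have "(q - g) \<bullet> (x - q) < 0" by blast
      then show ?thesis by (simp add: inner_diff_right)
    qed simp
  qed
  then have "convex hull (polytope_vertices P) \<subseteq> {x. (q - g) \<bullet> x \<le> (q - g) \<bullet> q}"
    by (rule hull_minimal) (rule convex_halfspace_le)
  then have le: "(q - g) \<bullet> x \<le> (q - g) \<bullet> q" if "x \<in> P" for x
    using polytope_eq_hull_vertices[OF P(1)] that by auto
  have Heq: "?H = P \<inter> {x. (q - g) \<bullet> x = (q - g) \<bullet> q}"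
    by (auto simp: perp_hyperplane_def inner_diff_right)
  have face: "?H face_of P" unfolding Heq
    using polytope_imp_convex[OF P(1)] le by (rule face_of_Int_supporting_hyperplane_le)
  have "polytope_vertices ?H \<subseteq> {q}"
  proof
    fix x assume "x \<in> polytope_vertices ?H"
    then have "x \<in> polytope_vertices P" "(q - g) \<bullet> (x - q) = 0"
      unfolding face_vertices[OF face] by (auto simp: perp_hyperplane_def)
    moreover from this(2) have "\<not> (q - g) \<bullet> (x - q) < 0" by simp
    ultimately show "x \<in> {q}" using R by blast
  qed
  then have "?H \<subseteq> {q}"
    using polytope_eq_hull_vertices[OF face_of_polytope_polytope[OF P(1) face]]
    by (metis convex_hull_singleton hull_mono)
  moreover have "q \<in> ?H" using qP by (simp add: perp_hyperplane_def)
  ultimately have H: "?H = {q}" by auto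
  have qf: "{q} face_of P" using ext by (simp add: face_of_singleton)
  have only: "F = {q}" if "F face_of P" "q \<in> rel_interior F" for F
  proof -
    have "F \<subseteq> {q}" using subset_of_face_of[OF qf face_of_imp_subset[OF that(1)]] that(2) by auto
    then show ?thesis using that(2) rel_interior_subset by blast
  qed
  have faces: "{F. F face_of P \<and> 0 \<le> aff_dim F \<and> aff_dim F < aff_dim P \<and> q \<in> rel_interior F} = {?H}"
    unfolding H
  proof (intro equalityI subsetI)
    fix F assume "F \<in> {F. F face_of P \<and> 0 \<le> aff_dim F \<and> aff_dim F < aff_dim P \<and> q \<in> rel_interior F}"
    then show "F \<in> {{q}}" using only by blast
  next
    fix F assume "F \<in> {{q}}"
    then have "F = {q}" by simp
    then show "F \<in> {F. F face_of P \<and> 0 \<le> aff_dim F \<and> aff_dim F < aff_dim P \<and> q \<in> rel_interior F}"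
      using qf P(2) by simp
  qed
  have "closed P" using P(1) by (simp add: polytope_imp_closed)
  then have "q \<in> frontier P"
    using qP extreme_point_not_in_interior[OF ext] by (simp add: frontier_def)
  then have "equilibrium_point P g q"
    using qP le by (simp add: equilibrium_point_def inner_diff_right)
  then have "nondegenerate_equilibrium P g q"
    unfolding nondegenerate_equilibrium_def using faces by (rule conjI)
  then show ?L using H by (simp add: unstable_equilibrium_def)
qed

text \<open>After a translation the centre of mass is the origin. The vertex \<open>r\<close> farthest from it is always an
  unstable equilibrium. Any other vertex \<open>x\<close> fails to be one because of some vertex \<open>y\<close> with
  \<open>x \<bullet> x \<le> x \<bullet> y\<close>, which is then farther away; taking \<open>y\<close> as parent of \<open>x\<close> makes the vertices a tree
  with root \<open>r\<close> and sum zero.\<close>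

theorem mono_unstable_vertices:
  fixes P :: "'a::euclidean_space set"
  assumes P: "polytope P" "0 < aff_dim P" and mono: "mono_unstable0 P"
  shows "10 < card (polytope_vertices P)"
proof (rule ccontr)
  assume small: "\<not> ?thesis"
  let ?V = "polytope_vertices P"
  define g where "g = center_of_mass0 P"
  have finV: "finite ?V" using P(1) by (rule polytope_vertices_finite)
  have "P \<noteq> {}" using P(2) by auto
  then have gP: "g \<in> P" and neV: "?V \<noteq> {}"
    using center_in_polytope[OF P(1)] polytope_eq_hull_vertices[OF P(1)] by (auto simp: g_def)
  note unst = unstable_equilibrium_iff[OF P gP]
  define X where "X = (\<lambda>v. v - g) ` ?V"
  have finX: "finite X" and neX: "X \<noteq> {}" using finV neV by (auto simp: X_def)
  have cardX: "card X \<le> 10" using small card_image_le[OF finV, of "\<lambda>v. v - g"] by (simp add: X_def)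
  have sumX: "(\<Sum>x\<in>X. x) = 0"
  proof -
    have "(\<Sum>x\<in>X. x) = (\<Sum>v\<in>?V. v - g)" unfolding X_def by (subst sum.reindex) (auto simp: inj_on_def)
    also have "\<dots> = (\<Sum>v\<in>?V. v) - real (card ?V) *\<^sub>R g" by (simp add: sum_subtractf sum_constant_scaleR)
    also have "\<dots> = 0" using finV neV by (simp add: g_def center_of_mass0_def)
    finally show ?thesis .
  qed
  have closer: "norm x < norm y" if "x \<bullet> x \<le> x \<bullet> y" "y \<noteq> x" for x y :: 'a
  proof -
    have "0 < (y - x) \<bullet> (y - x)" using that by simp
    then have "x \<bullet> x < y \<bullet> y" using that by (simp add: inner_diff_left inner_diff_right inner_commute)
    then show ?thesis by (simp add: norm_eq_sqrt_inner)
  qed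
  define r where "r = arg_min_on (\<lambda>x. - norm x) X"
  have r: "r \<in> X" "\<And>x. x \<in> X \<Longrightarrow> norm x \<le> norm r"
    using arg_min_if_finite(1)[OF finX neX, of "\<lambda>x. - norm x"]
      arg_min_least[OF finX neX, of _ "\<lambda>x. - norm x"]
    by (auto simp: r_def)
  have unstX: "unstable_equilibrium P g (x + g) \<longleftrightarrow> (\<forall>y\<in>X - {x}. x \<bullet> y < x \<bullet> x)" if "x \<in> X" for x
  proof -
    have "x + g \<in> ?V" using that by (auto simp: X_def)
    then have "unstable_equilibrium P g (x + g) \<longleftrightarrow> (\<forall>v\<in>?V - {x + g}. x \<bullet> (v - (x + g)) < 0)"
      unfolding unst by simp
    also have "\<dots> \<longleftrightarrow> (\<forall>v\<in>?V - {x + g}. x \<bullet> (v - g) < x \<bullet> x)"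
      by (simp add: inner_diff_right inner_add_right algebra_simps)
    also have "\<dots> \<longleftrightarrow> (\<forall>y\<in>(\<lambda>v. v - g) ` (?V - {x + g}). x \<bullet> y < x \<bullet> x)" by blast
    also have "(\<lambda>v. v - g) ` (?V - {x + g}) = X - {x}" by (force simp: X_def)
    finally show ?thesis .
  qed
  have unst_r: "unstable_equilibrium P g (r + g)"
    unfolding unstX[OF r(1)]
  proof
    fix y assume y: "y \<in> X - {r}"
    then have "\<not> norm r < norm y" using r(2)[of y] by simp
    then have "\<not> r \<bullet> r \<le> r \<bullet> y" using closer[of r y] y by blast
    then show "r \<bullet> y < r \<bullet> r" by simp
  qed
  have uniq: "x = r" if "unstable_equilibrium P g (x + g)" for x
  proof -
    have "card {q. unstable_equilibrium P g q} = 1"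
      using mono by (simp add: mono_unstable0_def g_def)
    then obtain s where "{q. unstable_equilibrium P g q} = {s}" by (rule card_1_singletonE)
    then have "x + g = s" "r + g = s" using that unst_r by auto
    then show ?thesis by (metis add_right_cancel)
  qed
  have "\<exists>y\<in>X. y \<noteq> x \<and> x \<bullet> x \<le> x \<bullet> y" if "x \<in> X - {r}" for x
    using uniq[of x] unstX[of x] that by (auto simp: not_less)
  then obtain f where f: "\<And>x. x \<in> X - {r} \<Longrightarrow> f x \<in> X \<and> f x \<noteq> x \<and> x \<bullet> x \<le> x \<bullet> f x"
    by metis
  have forest: "forest f r (X - {r})"
    unfolding forest_def using finX f closer by auto
  have "r \<noteq> 0"
  proof
    assume "r = 0"
    then have "X \<subseteq> {0}" using r(2) by fastforce
    then have "?V \<subseteq> {g}" by (auto simp: X_def)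
    then have "P \<subseteq> {g}"
      using polytope_eq_hull_vertices[OF P(1)] by (metis convex_hull_singleton hull_mono)
    then show False using aff_dim_subset[of P "{g}"] P(2) by simp
  qed
  moreover have "card (X - {r}) \<le> 9" using cardX finX r(1) by simp
  moreover have "r + (\<Sum>x\<in>X - {r}. x) = 0" using sumX finX r(1) by (simp add: sum.remove)
  ultimately show False using no_small_tree[OF forest] by simp
qed

lemma num_faces2_eq_facets: "aff_dim P = 3 \<Longrightarrow> num_faces2 P = card {F. F facet_of P}"
  unfolding num_faces2_def facet_of_def by (rule arg_cong[where f = card]) auto

corollary mono_unstable_faces:
  fixes P :: "'a::euclidean_space set"
  assumes "DIM('a) = 3" "polytope P" "aff_dim P = 3" "mono_unstable0 P"
  shows "8 \<le> num_faces2 P"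
  using vertices_le_facets[OF assms(1-3)] mono_unstable_vertices[OF assms(2) _ assms(4)]
    num_faces2_eq_facets[OF assms(3)] assms(3) by simp

section \<open>A mono-unstable polytope with eight faces\<close>

text \<open>A relative interior point of a facet must lie on one of the bounding hyperplanes, and then the
  facet is what this hyperplane cuts out. The halfspaces may be redundant.\<close>

lemma facets_le_halfspaces:
  fixes P :: "'a::euclidean_space set"
  assumes fin: "finite H" and H: "\<And>a b. (a, b) \<in> H \<Longrightarrow> a \<noteq> 0"
    and P: "P = {x. \<forall>(a, b)\<in>H. a \<bullet> x \<le> b}" and dim: "aff_dim P = DIM('a)"
  shows "card {F. F facet_of P} \<le> card H"
proof -
  have cvx: "convex P"
  proof -
    have "P = (\<Inter>(a, b)\<in>H. {x. a \<bullet> x \<le> b})" unfolding P by auto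
    then show ?thesis by (auto intro!: convex_INT convex_halfspace_le)
  qed
  have "\<exists>h\<in>H. F = P \<inter> {x. fst h \<bullet> x = snd h}" if F: "F facet_of P" for F
  proof -
    have Ff: "F face_of P" and dF: "aff_dim F = aff_dim P - 1" and neF: "F \<noteq> {}"
      using F by (auto simp: facet_of_def)
    obtain q where q: "q \<in> rel_interior F"
      using rel_interior_eq_empty[OF face_of_imp_convex[OF Ff]] neF by blast
    have qF: "q \<in> F" using q rel_interior_subset by blast
    have "F \<noteq> P" using dF by auto
    have "\<exists>(a, b)\<in>H. a \<bullet> q = b"
    proof (rule ccontr)
      assume no: "\<not> ?thesis"
      let ?O = "\<Inter>(a, b)\<in>H. {x. a \<bullet> x < b}"
      have opn: "open ?O" using fin by (auto intro!: open_INT open_halfspace_lt)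
      have sub: "?O \<subseteq> P" unfolding P by (auto intro: less_imp_le)
      have "a \<bullet> q < b" if "(a, b) \<in> H" for a b
      proof -
        have "q \<in> P" using face_of_imp_subset[OF Ff] qF by blast
        then have "a \<bullet> q \<le> b" using that unfolding P by blast
        moreover have "a \<bullet> q \<noteq> b" using no that by blast
        ultimately show ?thesis by simp
      qed
      then have "q \<in> ?O" by blast
      with opn have "q \<in> interior P" using sub by (rule interiorI)
      then show False using face_of_disjoint_interior[OF Ff \<open>F \<noteq> P\<close>] qF by auto
    qed
    then obtain a b where ab: "(a, b) \<in> H" "a \<bullet> q = b" by blast
    let ?G = "P \<inter> {x. a \<bullet> x = b}"
    have G: "?G face_of P"
      using cvx by (rule face_of_Int_supporting_hyperplane_le) (use ab(1) in \<open>auto simp: P\<close>)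
    have FP: "F \<subseteq> P" using face_of_imp_subset[OF Ff] .
    have "F \<subseteq> ?G"
      using q qF FP ab(2) by (intro subset_of_face_of[OF G FP]) auto
    then have "F face_of ?G" using face_of_subset[OF Ff] by auto
    moreover have "?G \<noteq> P"
    proof
      assume "?G = P"
      then have "P \<subseteq> {x. a \<bullet> x = b}" by blast
      then show False using aff_dim_subset[of P "{x. a \<bullet> x = b}"] dim H[OF ab(1)] by simp
    qed
    then have "aff_dim ?G < aff_dim P" using face_of_aff_dim_lt[OF cvx G] by simp
    ultimately have "F = ?G"
      using face_of_aff_dim_lt[OF face_of_imp_convex[OF G]] dF by fastforce
    then show ?thesis using ab(1) by (intro bexI[of _ "(a, b)"]) auto
  qed
  then have "{F. F facet_of P} \<subseteq> (\<lambda>h. P \<inter> {x. fst h \<bullet> x = snd h}) ` H" by blast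
  then have "card {F. F facet_of P} \<le> card ((\<lambda>h. P \<inter> {x. fst h \<bullet> x = snd h}) ` H)"
    using fin by (intro card_mono) auto
  also have "\<dots> \<le> card H" using fin by (rule card_image_le)
  finally show ?thesis .
qed

lemma extreme_point_by_active:
  fixes P :: "'a::euclidean_space set"
  assumes P: "P = {x. \<forall>(a, b)\<in>H. a \<bullet> x \<le> b}" and v: "v \<in> P"
    and uniq: "\<And>x. (\<And>a b. (a, b) \<in> H \<Longrightarrow> a \<bullet> v = b \<Longrightarrow> a \<bullet> x = b) \<Longrightarrow> x = v"
  shows "v extreme_point_of P"
  unfolding extreme_point_of_def
proof (intro conjI v ballI notI)
  fix x y assume xy: "x \<in> P" "y \<in> P" and seg: "v \<in> open_segment x y"
  obtain u where u: "0 < u" "u < 1" "v = (1 - u) *\<^sub>R x + u *\<^sub>R y" and ne: "x \<noteq> y"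
    using seg by (auto simp: in_segment)
  have "a \<bullet> x = b \<and> a \<bullet> y = b" if ab: "(a, b) \<in> H" "a \<bullet> v = b" for a b
  proof -
    have le: "a \<bullet> x \<le> b" "a \<bullet> y \<le> b" using xy ab(1) by (auto simp: P)
    have "(1 - u) * (b - a \<bullet> x) + u * (b - a \<bullet> y) = 0"
      using ab(2) by (simp add: u(3) inner_add_right algebra_simps)
    moreover have "0 \<le> (1 - u) * (b - a \<bullet> x)" "0 \<le> u * (b - a \<bullet> y)" using u le by auto
    ultimately have "(1 - u) * (b - a \<bullet> x) = 0" "u * (b - a \<bullet> y) = 0" by linarith+
    then show ?thesis using u by auto
  qed
  then have "x = v" "y = v" using uniq by blast+
  with ne show False by simp
qed

abbreviation v3 :: "real \<Rightarrow> real \<Rightarrow> real \<Rightarrow> real^3" where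
  "v3 x y z \<equiv> vector [x, y, z]"

lemma v3_simps:
  "v3 a b c = v3 a' b' c' \<longleftrightarrow> a = a' \<and> b = b' \<and> c = c'"
  "v3 a b c + v3 a' b' c' = v3 (a + a') (b + b') (c + c')"
  "v3 a b c - v3 a' b' c' = v3 (a - a') (b - b') (c - c')"
  "t *\<^sub>R v3 a b c = v3 (t * a) (t * b) (t * c)"
  "v3 a b c \<bullet> v3 a' b' c' = a * a' + b * b' + c * c'"
  "v3 a b c \<bullet> x = a * x$1 + b * x$2 + c * x$3"
  "0 = v3 0 0 0"
  by (auto simp: vec_eq_iff forall_3 inner_vec_def sum_3)

text \<open>The example is a wedge \<open>2 * y \<ge> \<bar>x\<bar>\<close> cut off by six planes parallel to the \<open>x\<close>-axis. Its vertices
  are the two points on the edge of the wedge and two mirror-symmetric spirals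
  \<open>(12,6,7), (10,5,-2), (6,3,-6), (4,2,-7), (2,1,-7)\<close> and \<open>(-12,6,7), ...\<close> that lead down from the
  highest point \<open>(0,0,36)\<close>. Each point of a spiral fails to be an equilibrium because of the point before
  it, and \<open>(0,0,-6)\<close> because of the lower ends of the spirals. The facets
  in the planes \<open>x = 2 * y\<close> and \<open>- x = 2 * y\<close> are heptagons, joined by the other six.\<close>

definition wedge_halfspaces :: "((real^3) \<times> real) list" where
  "wedge_halfspaces =
    [(v3 1 (-2) 0, 0), (v3 (-1) (-2) 0, 0), (v3 0 29 6, 216), (v3 0 9 (-1), 47),
     (v3 0 2 (-1), 12), (v3 0 1 (-1), 9), (v3 0 0 (-1), 7), (v3 0 (-1) (-1), 6)]"

definition wedge :: "(real^3) set" where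
  "wedge = {x. \<forall>(a, b)\<in>set wedge_halfspaces. a \<bullet> x \<le> b}"

definition wedge_vertices :: "(real^3) list" where
  "wedge_vertices =
    [v3 0 0 36, v3 12 6 7, v3 10 5 (-2), v3 6 3 (-6), v3 4 2 (-7), v3 2 1 (-7),
     v3 (-12) 6 7, v3 (-10) 5 (-2), v3 (-6) 3 (-6), v3 (-4) 2 (-7), v3 (-2) 1 (-7), v3 0 0 (-6)]"

lemma mem_wedge:
  "x \<in> wedge \<longleftrightarrow> x$1 \<le> 2 * x$2 \<and> - x$1 \<le> 2 * x$2 \<and> 29 * x$2 + 6 * x$3 \<le> 216 \<and> 9 * x$2 - x$3 \<le> 47 \<and>
     2 * x$2 - x$3 \<le> 12 \<and> x$2 - x$3 \<le> 9 \<and> - x$3 \<le> 7 \<and> - x$2 - x$3 \<le> 6"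
  by (auto simp: wedge_def wedge_halfspaces_def v3_simps(6))

lemma polytope_wedge: "polytope wedge"
proof -
  have "wedge = \<Inter>((\<lambda>(a, b). {x. a \<bullet> x \<le> b}) ` set wedge_halfspaces)"
    by (auto simp: wedge_def)
  moreover have "polyhedron (\<Inter>((\<lambda>(a, b). {x. a \<bullet> x \<le> b}) ` set wedge_halfspaces))"
    by (intro polyhedron_Inter) (auto simp: polyhedron_halfspace_le)
  ultimately have "polyhedron wedge" by simp
  moreover have "wedge \<subseteq> cbox (v3 (-18) 0 (-7)) (v3 18 9 36)"
    by (auto simp: mem_wedge mem_box_cart forall_3)
  then have "bounded wedge" using bounded_subset bounded_cbox by blast
  ultimately show ?thesis by (simp add: polytope_eq_bounded_polyhedron)
qed

lemma aff_dim_wedge: "aff_dim wedge = 3"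
proof -
  let ?O = "\<Inter>(a, b)\<in>set wedge_halfspaces. {x. a \<bullet> x < b}"
  have opn: "open ?O" by (auto intro!: open_INT open_halfspace_lt)
  have sub: "?O \<subseteq> wedge" by (auto simp: wedge_def intro: less_imp_le)
  have "v3 0 1 0 \<in> ?O" by (simp add: wedge_halfspaces_def v3_simps(5))
  with opn have "v3 0 1 0 \<in> interior wedge" using sub by (rule interiorI)
  then have "aff_dim wedge = DIM(real^3)" by (intro aff_dim_nonempty_interior) auto
  then show ?thesis by simp
qed

lemma facets_wedge: "card {F. F facet_of wedge} \<le> 8"
proof -
  have "card {F. F facet_of wedge} \<le> card (set wedge_halfspaces)"
    by (rule facets_le_halfspaces[OF _ _ wedge_def])
      (auto simp: aff_dim_wedge wedge_halfspaces_def v3_simps(1,7))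
  also have "\<dots> \<le> length wedge_halfspaces" by (rule card_length)
  finally show ?thesis by (simp add: wedge_halfspaces_def)
qed

lemma distinct_wedge_vertices: "distinct wedge_vertices"
  by (simp add: wedge_vertices_def v3_simps(1))

lemma length_wedge_vertices: "length wedge_vertices = 12"
  by (simp add: wedge_vertices_def)

lemma wedge_vertexI:
  assumes v: "v \<in> wedge"
    and uniq: "\<And>x :: real^3. \<lbrakk>v$1 = 2 * v$2 \<Longrightarrow> x$1 = 2 * x$2; - v$1 = 2 * v$2 \<Longrightarrow> - x$1 = 2 * x$2;
      29 * v$2 + 6 * v$3 = 216 \<Longrightarrow> 29 * x$2 + 6 * x$3 = 216; 9 * v$2 - v$3 = 47 \<Longrightarrow> 9 * x$2 - x$3 = 47;
      2 * v$2 - v$3 = 12 \<Longrightarrow> 2 * x$2 - x$3 = 12; v$2 - v$3 = 9 \<Longrightarrow> x$2 - x$3 = 9;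
      - v$3 = 7 \<Longrightarrow> - x$3 = 7; - v$2 - v$3 = 6 \<Longrightarrow> - x$2 - x$3 = 6\<rbrakk> \<Longrightarrow> x = v"
  shows "v extreme_point_of wedge"
proof (rule extreme_point_by_active[OF wedge_def v])
  fix x assume act: "\<And>a b. (a, b) \<in> set wedge_halfspaces \<Longrightarrow> a \<bullet> v = b \<Longrightarrow> a \<bullet> x = b"
  have *: "a * v$1 + b * v$2 + c * v$3 = d \<Longrightarrow> a * x$1 + b * x$2 + c * x$3 = d"
    if "(v3 a b c, d) \<in> set wedge_halfspaces" for a b c d
    using act[OF that] by (simp add: v3_simps(6))
  show "x = v"
    using *[of 1 "-2" 0 0] *[of "-1" "-2" 0 0] *[of 0 29 6 216] *[of 0 9 "-1" 47] *[of 0 2 "-1" 12]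
      *[of 0 1 "-1" 9] *[of 0 0 "-1" 7] *[of 0 "-1" "-1" 6]
    by (intro uniq) (simp_all add: wedge_halfspaces_def)
qed

lemma wedge_vertices_extreme: "\<forall>v\<in>set wedge_vertices. v extreme_point_of wedge"
  unfolding wedge_vertices_def list.set ball_simps
  by (intro conjI TrueI; rule wedge_vertexI; simp add: mem_wedge vec_eq_iff forall_3)

text \<open>Twelve vertices are the most that eight facets allow, so no other points need to be examined.\<close>

lemma polytope_vertices_wedge: "polytope_vertices wedge = set wedge_vertices"
proof (rule card_seteq[symmetric])
  show "finite (polytope_vertices wedge)" using polytope_wedge by (rule polytope_vertices_finite)
  show "set wedge_vertices \<subseteq> polytope_vertices wedge"
    using wedge_vertices_extreme by (auto simp: polytope_vertices_def)
  have "card (set wedge_vertices) = 12"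
    by (simp add: distinct_card distinct_wedge_vertices length_wedge_vertices)
  then show "card (polytope_vertices wedge) \<le> card (set wedge_vertices)"
    using vertices_le_facets[OF _ polytope_wedge aff_dim_wedge] facets_wedge by simp
qed

lemma center_wedge: "center_of_mass0 wedge = v3 0 (17/6) 0"
proof -
  have "(\<Sum>v\<in>set wedge_vertices. v) = sum_list wedge_vertices"
    using sum.distinct_set_conv_list[OF distinct_wedge_vertices, of "\<lambda>v. v"] by simp
  also have "\<dots> = v3 0 34 0"
    unfolding wedge_vertices_def by (simp add: v3_simps(2) v3_simps(7))
  finally have "(\<Sum>v\<in>set wedge_vertices. v) = v3 0 34 0" .
  moreover have "card (set wedge_vertices) = 12"
    by (simp add: distinct_card distinct_wedge_vertices length_wedge_vertices)
  ultimately show ?thesis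
    by (simp add: center_of_mass0_def polytope_vertices_wedge v3_simps(4))
qed

lemma mono_unstable_wedge: "mono_unstable0 wedge"
proof -
  let ?g = "v3 0 (17/6) 0"
  have gw: "?g \<in> wedge" by (simp add: mem_wedge)
  let ?r = "v3 0 0 36"
  have pos: "0 < aff_dim wedge" by (simp add: aff_dim_wedge)
  have unst: "unstable_equilibrium wedge ?g q \<longleftrightarrow>
      q \<in> set wedge_vertices \<and> (\<forall>x\<in>set wedge_vertices - {q}. (q - ?g) \<bullet> (x - q) < 0)" for q
    unfolding unstable_equilibrium_iff[OF polytope_wedge pos gw] polytope_vertices_wedge ..
  have r: "?r \<in> set wedge_vertices" by (simp add: wedge_vertices_def)
  have top: "\<forall>x\<in>set wedge_vertices. x \<noteq> ?r \<longrightarrow> (?r - ?g) \<bullet> (x - ?r) < 0"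
    unfolding wedge_vertices_def by (simp add: v3_simps(1,3,5))
  have rest: "\<forall>q\<in>set wedge_vertices. q \<noteq> ?r \<longrightarrow>
      (\<exists>x\<in>set wedge_vertices. x \<noteq> q \<and> \<not> (q - ?g) \<bullet> (x - q) < 0)"
    unfolding wedge_vertices_def by (simp add: v3_simps(1,3,5))
  have "{q. unstable_equilibrium wedge ?g q} = {?r}"
    unfolding unst using r top rest by blast
  then show ?thesis by (simp add: mono_unstable0_def center_wedge)
qed

theorem mainTheorem4:
  "(\<exists>P :: (real ^ 3) set. polytope P \<and> aff_dim P = 3 \<and> mono_unstable0 P \<and> num_faces2 P = 8) \<and>
   (\<forall>P :: (real ^ 3) set. polytope P \<and> aff_dim P = 3 \<and> mono_unstable0 P \<longrightarrow> 8 \<le> num_faces2 P)"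
proof -
  have lower: "8 \<le> num_faces2 P" if "polytope P" "aff_dim P = 3" "mono_unstable0 P" for P :: "(real^3) set"
    by (rule mono_unstable_faces[OF _ that]) simp
  have "num_faces2 wedge \<le> 8"
    using facets_wedge by (simp add: num_faces2_eq_facets[OF aff_dim_wedge])
  with lower[OF polytope_wedge aff_dim_wedge mono_unstable_wedge] have "num_faces2 wedge = 8"
    by (rule order_antisym[rotated])
  with polytope_wedge aff_dim_wedge mono_unstable_wedge lower show ?thesis by blast
qed

end
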